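(* Let $X\sim\mathcal{MN}_{n\times p}(\mu,I_n,\Sigma)$ (independent rows $X_i\sim\mathcal{N}_p(\mu_i,\Sigma)$) with $\Sigma$ known positive definite, and run the randomized agglomerative clustering algorithm of the context on $X$. Fix $t$ and a possible realization $m=(m^{(1)},\dots,m^{(t)})$ of the first $t$ merges with $m^{(t)}=(C_1,C_2)$, define $\nu,U,\mathcal{A}_\Sigma$ and $X(u;\cdot)$ with respect to $(C_1,C_2)$, and suppose $H_0^{(t)}:\bar\mu_{C_1}=\bar\mu_{C_2}$ holds. Then for any value $\mathcal{A}_{\Sigma,o}$ of $\mathcal{A}_\Sigma$, the conditional distribution of $U$ given $\{\mathcal{A}_\Sigma=\mathcal{A}_{\Sigma,o},\ (M^{(1)},\dots,M^{(t)})=m\}$ has cumulative distribution function $$\mathbb{F}^{(t)}(u;\mathcal{A}_{\Sigma,o},m)=\frac{\int_0^u \ell_{\|\nu\|_2\chi_p}(u')\prod_{s=1}^t p^{(s)}\big(m^{(s)};X(u';\mathcal{A}_{\Sigma,o})\big)\,du'}{\int_0^\infty \ell_{\|\nu\|_2\chi_p}(u')\prod_{s=1}^t p^{(s)}\big(m^{(s)};X(u';\mathcal{A}_{\Sigma,o})\big)\,du'},$$ where $\ell_{\|\nu\|_2\chi_p}$ is the density of $\|\nu\|_2$ times a $\chi_p$ random variable.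
   Context: Randomized agglomerative clustering: start with singletons; at step $s$, $\mathcal{M}^{(s)}$ is the set of pairs of distinct current clusters, $d(M;x)\ge0$ a linkage dissimilarity; given $X=x$ the merge $M^{(s)}$ is drawn with probability $p^{(s)}(M;x)=\exp(-d(M;x)/\tau^{(s)})/\sum_{M'\in\mathcal{M}^{(s)}}\exp(-d(M';x)/\tau^{(s)})$, with $\tau^{(s)}=\tau\,|\mathcal{M}^{(s)}|^{-1}\sum_{M'\in\mathcal{M}^{(s)}}d(M';x)>0$, $\tau>0$ fixed; merged clusters are replaced by their union; draws independent across steps given data; $p^{(s)}(m^{(s)};x)$ uses the candidate set determined by $m^{(1)},\dots,m^{(s-1)}$. Test quantities: $\bar\mu_C=|C|^{-1}\sum_{i\in C}\mu_i$; $\nu_i=\mathbb{1}\{i\in C_1\}/|C_1|-\mathbb{1}\{i\in C_2\}/|C_2|$; $U=\|\Sigma^{-1/2}X^\top\nu\|_2$; $\mathcal{A}_\Sigma=(\xi,\pi)$ with $\xi=(\Sigma^{-1/2}X^\top\nu/\|\Sigma^{-1/2}X^\top\nu\|_2)^\top$ and $\pi=(I_n-\nu\nu^\top/\|\nu\|_2^2)X$; for $a=(\xi_a,\pi_a)$ and $u>0$, $X(u;a)=u\,\nu\,\xi_a\Sigma^{1/2}/\|\nu\|_2^2+\pi_a$. *)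

theory Defs
  imports "HOL-Analysis.Analysis"
begin

definition pos_def_mat :: "real^'p^'p \<Rightarrow> bool" where
  "pos_def_mat S \<longleftrightarrow> transpose S = S \<and> (\<forall>v. v \<noteq> 0 \<longrightarrow> v \<bullet> (S *v v) > 0)"

definition psd_mat :: "real^'p^'p \<Rightarrow> bool" where
  "psd_mat S \<longleftrightarrow> transpose S = S \<and> (\<forall>v. v \<bullet> (S *v v) \<ge> 0)"

definition msqrt :: "real^'p^'p \<Rightarrow> real^'p^'p" where
  "msqrt S = (THE R. psd_mat R \<and> R ** R = S)"

definition minvsqrt :: "real^'p^'p \<Rightarrow> real^'p^'p" where
  "minvsqrt S = matrix_inv (msqrt S)"

section \<open>Matrix normal density MN(mu, I_n, Sigma): independent rows N_p(mu_i, Sigma)\<close>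

definition mn_density :: "real^'p^'n \<Rightarrow> real^'p^'p \<Rightarrow> real^'p^'n \<Rightarrow> real" where
  "mn_density \<mu> \<Sigma> x = (\<Prod>i\<in>UNIV.
      (2 * pi) powr (- real CARD('p) / 2) * det \<Sigma> powr (-1/2) *
      exp (- (1/2) * ((x$i - \<mu>$i) \<bullet> (matrix_inv \<Sigma> *v (x$i - \<mu>$i)))))"

definition chi_density :: "nat \<Rightarrow> real \<Rightarrow> real" where
  "chi_density k z = (if z \<ge> 0 then z ^ (k - 1) * exp (- (z\<^sup>2) / 2) /
       (2 powr (real k / 2 - 1) * Gamma (real k / 2)) else 0)"

definition scaled_chi_density :: "real \<Rightarrow> nat \<Rightarrow> real \<Rightarrow> real" where
  "scaled_chi_density c k u = chi_density k (u / c) / c"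

text \<open>Clusters are sets of observation indices; a merge is an unordered pair {C, C'}
  of distinct current clusters; a partition is the set of current clusters.\<close>

definition init_part :: "'n set set" where
  "init_part = (\<lambda>i. {i}) ` UNIV"

definition merge_part :: "'n set set \<Rightarrow> 'n set set \<Rightarrow> 'n set set" where
  "merge_part P M = (P - M) \<union> {\<Union>M}"

definition part_after :: "'n set set list \<Rightarrow> nat \<Rightarrow> 'n set set" where
  "part_after ms s = foldl merge_part init_part (take s ms)"

definition candidates :: "'n set set \<Rightarrow> 'n set set set" where
  "candidates P = {M. M \<subseteq> P \<and> card M = 2}"

definition valid_merges :: "'n set set list \<Rightarrow> bool" where
  "valid_merges ms \<longleftrightarrow> (\<forall>s < length ms. ms ! s \<in> candidates (part_after ms s))"

definition temp :: "real \<Rightarrow> ('n set set \<Rightarrow> 'x \<Rightarrow> real) \<Rightarrow> 'n set set \<Rightarrow> 'x \<Rightarrow> real" where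
  "temp \<tau> d P x = \<tau> * (\<Sum>M'\<in>candidates P. d M' x) / real (card (candidates P))"

definition merge_prob :: "real \<Rightarrow> ('n set set \<Rightarrow> 'x \<Rightarrow> real) \<Rightarrow> 'n set set \<Rightarrow> 'n set set \<Rightarrow> 'x \<Rightarrow> real" where
  "merge_prob \<tau> d P M x =
     exp (- d M x / temp \<tau> d P x) / (\<Sum>M'\<in>candidates P. exp (- d M' x / temp \<tau> d P x))"

text \<open>P(M^(1..t) = ms | X = x) = prod_s p^(s)(m^(s); x), candidate sets determined by earlier merges.\<close>
definition path_prob :: "real \<Rightarrow> ('n set set \<Rightarrow> 'x \<Rightarrow> real) \<Rightarrow> 'n set set list \<Rightarrow> 'x \<Rightarrow> real" where
  "path_prob \<tau> d ms x = (\<Prod>s<length ms. merge_prob \<tau> d (part_after ms s) (ms ! s) x)"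

definition mean_row :: "real^'p^'n \<Rightarrow> 'n set \<Rightarrow> real^'p" where
  "mean_row \<mu> C = (1 / real (card C)) *\<^sub>R (\<Sum>i\<in>C. \<mu> $ i)"

definition contrast :: "'n set \<Rightarrow> 'n set \<Rightarrow> real^'n" where
  "contrast C1 C2 = (\<chi> i. (if i \<in> C1 then 1 / real (card C1) else 0)
                         - (if i \<in> C2 then 1 / real (card C2) else 0))"

definition stat_U :: "real^'p^'p \<Rightarrow> real^'n \<Rightarrow> real^'p^'n \<Rightarrow> real" where
  "stat_U \<Sigma> \<nu> x = norm (minvsqrt \<Sigma> *v (transpose x *v \<nu>))"

definition stat_A :: "real^'p^'p \<Rightarrow> real^'n \<Rightarrow> real^'p^'n \<Rightarrow> (real^'p) \<times> (real^'p^'n)" where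
  "stat_A \<Sigma> \<nu> x =
     ((1 / norm (minvsqrt \<Sigma> *v (transpose x *v \<nu>))) *\<^sub>R (minvsqrt \<Sigma> *v (transpose x *v \<nu>)),
      (mat 1 - (1 / (norm \<nu>)^2) *\<^sub>R (\<chi> i j. \<nu> $ i * \<nu> $ j)) ** x)"

definition X_of :: "real^'p^'p \<Rightarrow> real^'n \<Rightarrow> real \<Rightarrow> (real^'p) \<times> (real^'p^'n) \<Rightarrow> real^'p^'n" where
  "X_of \<Sigma> \<nu> u a =
     (\<chi> i j. u * \<nu> $ i * ((fst a v* msqrt \<Sigma>) $ j) / (norm \<nu>)^2) + snd a"

definition cond_cdf :: "real^'p^'p \<Rightarrow> real \<Rightarrow> ('n set set \<Rightarrow> real^'p^'n \<Rightarrow> real)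
    \<Rightarrow> 'n set set list \<Rightarrow> real^'n \<Rightarrow> real \<Rightarrow> (real^'p) \<times> (real^'p^'n) \<Rightarrow> real" where
  "cond_cdf \<Sigma> \<tau> d ms \<nu> u a =
     (\<integral>u'. indicator {0..u} u' * scaled_chi_density (norm \<nu>) CARD('p) u'
                * path_prob \<tau> d ms (X_of \<Sigma> \<nu> u' a) \<partial>lborel) /
     (\<integral>u'. indicator {0..} u' * scaled_chi_density (norm \<nu>) CARD('p) u'
                * path_prob \<tau> d ms (X_of \<Sigma> \<nu> u' a) \<partial>lborel)"

end

theory Submission
  imports Defs "HOL-Probability.Distributions"
begin

text \<open>Dilating the component of \<open>x\<close> along \<open>\<nu>\<close> by a factor \<open>r > 0\<close> multiplies \<open>U\<close> by \<open>r\<close>, leaves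
  \<open>A\<^sub>\<Sigma>\<close> unchanged and scales Lebesgue measure by \<open>r\<close> to the power \<open>p\<close>. Hence Lebesgue measure
  disintegrates over the orbits \<open>u \<mapsto> X(u; a)\<close> with density proportional to \<open>u\<close> to the power
  \<open>p - 1\<close>. Under the null hypothesis \<open>\<nu>\<close> annihilates \<open>\<mu>\<close>, so on each orbit the Gaussian density is a
  function of \<open>a\<close> times \<open>exp (- u\<^sup>2 / (2 \<parallel>\<nu>\<parallel>\<^sup>2))\<close>, which together with the orbit density is a
  multiple of the scaled chi density. The two integrals of the claim therefore agree already orbit
  by orbit.\<close>

section \<open>Lebesgue measure under rotations and dilations\<close>

text \<open>A single value of \<open>stat_A\<close> is in general a null event, so the conditional
  law is stated in integrated form: over every Borel set \<open>B\<close> of values of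
  \<open>stat_A\<close>, averaging \<open>cond_cdf\<close> must reproduce the mass of the event
  \<open>stat_U\<close> \<le> \<open>u\<close>. The merges enter as the weight
  \<open>path_prob\<close> on the Gaussian density, the probability of the path given the data.
  Along one orbit, the weighted density cut off at \<open>u\<close> integrates to a constant times
  the numerator of \<open>cond_cdf\<close>, and without the cutoff to the same constant times the
  denominator. Since \<open>cond_cdf\<close> is constant on the orbit and is the quotient of the
  two, it converts the full integral into the truncated one. The denominator must be finite and
  nonzero for this, which comes from 0 < \<open>path_prob\<close> \<le> 1. A separate obstacle is
  that \<open>msqrt\<close> is a definite description: existence and uniqueness of a positive
  semidefinite root have to be settled before either statistic can be computed.\<close>

lemma nn_integral_lborel_plus:
  fixes f :: "'a::euclidean_space \<Rightarrow> ennreal"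
  assumes [measurable]: "f \<in> borel_measurable borel"
  shows "(\<integral>\<^sup>+x. f (t + x) \<partial>lborel) = (\<integral>\<^sup>+x. f x \<partial>lborel)"
  by (subst (2) lborel_distr_plus[symmetric, of t]) (simp add: nn_integral_distr)

text \<open>Uniqueness of translation-invariant measures: convolving with the indicator \<open>h\<close> of the unit ball
  shows proportionality, and the ball being invariant under \<open>T\<close> the factor is 1.\<close>
lemma nn_integral_lborel_orthogonal_transformation:
  fixes T :: "'a::euclidean_space \<Rightarrow> 'a" and f :: "'a \<Rightarrow> ennreal"
  assumes T: "orthogonal_transformation T"
    and [measurable]: "f \<in> borel_measurable borel"
  shows "(\<integral>\<^sup>+x. f (T x) \<partial>lborel) = (\<integral>\<^sup>+x. f x \<partial>lborel)"
proof -
  define h :: "'a \<Rightarrow> ennreal" where "h = indicator (ball 0 1)"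
  define V where "V = (\<integral>\<^sup>+x. h x \<partial>(lborel::'a measure))"
  have [measurable]: "h \<in> borel_measurable borel" unfolding h_def by (intro borel_measurable_indicator borel_open open_ball)
  have h: "h v = (if norm v < 1 then 1 else 0)" for v
    by (simp add: h_def indicator_def)
  have lin: "linear T" and norm_T: "\<And>x. norm (T x) = norm x"
    using T by (auto simp: orthogonal_transformation)
  have [measurable]: "T \<in> borel_measurable borel"
    using lin by (intro borel_measurable_continuous_onI linear_continuous_on)
      (simp add: linear_conv_bounded_linear)
  have surj: "\<exists>z. T z = y" for y
    using orthogonal_transformation_surj[OF T] by (metis surjD)
  have shift_f: "(\<integral>\<^sup>+x. f (T x + y) \<partial>lborel) = (\<integral>\<^sup>+x. f (T x) \<partial>lborel)" for y
  proof -
    obtain z where z: "T z = y" using surj by blast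
    show ?thesis
      using nn_integral_lborel_plus[of "\<lambda>x. f (T x)" z]
      by (simp add: linear_add[OF lin] z add.commute)
  qed
  have shift_h: "(\<integral>\<^sup>+x. h (y - T x) \<partial>lborel) = V" for y
  proof -
    obtain z where z: "T z = y" using surj by blast
    have "h (y - T x) = h (- z + x)" for x
    proof -
      have "norm (y - T x) = norm (- z + x)"
        by (metis z linear_diff[OF lin] norm_T norm_minus_commute uminus_add_conv_diff)
      then show ?thesis by (simp only: h)
    qed
    then show ?thesis
      using nn_integral_lborel_plus[of h "- z"] by (simp add: V_def)
  qed
  \<comment> \<open>By \<open>shift_f\<close> the inner integral does not depend on
    \<open>y\<close>, so \<open>V\<close> factors out. Moving the shift from \<open>f\<close> to
    \<open>h\<close> then leaves \<open>f\<close> free of \<open>T\<close>, and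
    \<open>shift_h\<close> evaluates the remaining integral of \<open>h\<close> to \<open>V\<close>
    again.\<close>
  have "(\<integral>\<^sup>+x. f (T x) \<partial>lborel) * V = (\<integral>\<^sup>+y. h y * (\<integral>\<^sup>+x. f (T x + y) \<partial>lborel) \<partial>lborel)"
    by (simp add: shift_f V_def nn_integral_multc mult.commute)
  also have "\<dots> = (\<integral>\<^sup>+y. (\<integral>\<^sup>+x. h y * f (T x + y) \<partial>lborel) \<partial>lborel)"
    by (simp add: nn_integral_cmult)
  also have "\<dots> = (\<integral>\<^sup>+x. (\<integral>\<^sup>+y. h y * f (T x + y) \<partial>lborel) \<partial>lborel)"
    by (rule lborel_pair.Fubini') simp
  also have "\<dots> = (\<integral>\<^sup>+x. (\<integral>\<^sup>+y. h (y - T x) * f y \<partial>lborel) \<partial>lborel)"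
    using nn_integral_lborel_plus[of "\<lambda>y. h (y - T x) * f y" "T x" for x] by simp
  also have "\<dots> = (\<integral>\<^sup>+y. (\<integral>\<^sup>+x. h (y - T x) * f y \<partial>lborel) \<partial>lborel)"
    by (rule lborel_pair.Fubini') simp
  also have "\<dots> = (\<integral>\<^sup>+y. V * f y \<partial>lborel)"
    by (simp add: nn_integral_multc shift_h)
  also have "\<dots> = (\<integral>\<^sup>+y. f y \<partial>lborel) * V"
    by (simp add: nn_integral_cmult mult.commute)
  finally have eq: "(\<integral>\<^sup>+x. f (T x) \<partial>lborel) * V = (\<integral>\<^sup>+y. f y \<partial>lborel) * V" .
  have "V = emeasure lborel (ball (0::'a) 1)" by (simp add: V_def h_def)
  moreover have "Sigma_Algebra.measure lborel (ball (0::'a) 1) > 0" by (rule content_ball_pos) simp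
  ultimately have "V \<noteq> 0" "V \<noteq> top"
    using emeasure_lborel_ball_finite[of "0::'a" 1] by (auto simp: measure_def)
  then show ?thesis using eq by (simp add: mult.commute[of _ V] ennreal_mult_cancel_left)
qed

text \<open>Weighting a point by the integral of \<open>k U^k r^(-k-1)\<close> over \<open>r > U\<close>, which is 1, and
  undoing the dilation by \<open>r\<close> replaces the integral over the whole space by one over
  \<open>0 < U < 1\<close> followed by an integral along the orbit; no quotient space is needed.\<close>
lemma nn_integral_dilation_orbits:
  fixes U :: "'a::euclidean_space \<Rightarrow> real" and S :: "real \<Rightarrow> 'a \<Rightarrow> 'a"
    and H :: "'a \<Rightarrow> ennreal" and k :: nat
  assumes [measurable]: "U \<in> borel_measurable borel"
      "(\<lambda>(r, x). S r x) \<in> borel_measurable borel" "H \<in> borel_measurable borel"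
    and k: "k > 0"
    and U_pos: "AE x in lborel. U x > 0"
    and U_S: "\<And>r x. r > 0 \<Longrightarrow> U (S r x) = r * U x"
    and scale: "\<And>r g. r > 0 \<Longrightarrow> g \<in> borel_measurable borel \<Longrightarrow>
      (\<integral>\<^sup>+x. g x \<partial>lborel) = ennreal (r ^ k) * (\<integral>\<^sup>+x. g (S r x) \<partial>lborel)"
  shows "(\<integral>\<^sup>+x. H x \<partial>lborel) =
    (\<integral>\<^sup>+x. indicator {x. 0 < U x \<and> U x < 1} x * (\<integral>\<^sup>+v. ennreal (real k * v ^ (k - 1)) *
       indicator {0<..} v * H (S (v / U x) x) \<partial>lborel) \<partial>lborel)"
proof -
  have [measurable]: "S r \<in> borel_measurable borel" for r
  proof -
    have "(\<lambda>x. (\<lambda>(r, x). S r x) (r, x)) \<in> borel_measurable borel" by measurable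
    then show ?thesis by simp
  qed
  have [measurable]: "(\<lambda>(r, x). S r x) \<in> borel_measurable (borel \<Otimes>\<^sub>M borel)"
    using assms(2) by (simp add: borel_prod)
  define w where "w = (\<lambda>r x. ennreal (real k * U x ^ k / r ^ (k + 1)) * indicator {r. 0 < U x \<and> U x < r} r)"
  have [measurable]: "(\<lambda>(r, x). w r x) \<in> borel_measurable (borel \<Otimes>\<^sub>M borel)"
    unfolding w_def by measurable
  have w1: "(\<integral>\<^sup>+r. w r x \<partial>lborel) = 1" if pos: "U x > 0" for x
  proof -
    have "(\<integral>\<^sup>+r. w r x \<partial>lborel) = (\<integral>\<^sup>+r. ennreal (real k * U x ^ k / r ^ (k + 1)) * indicator {U x..} r \<partial>lborel)"
      using AE_lborel_singleton[of "U x"] pos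
      by (intro nn_integral_cong_AE) (auto simp: w_def indicator_def elim: eventually_mono)
    also have "\<dots> = ennreal (0 - (- (U x ^ k / U x ^ k)))"
    proof (rule nn_integral_FTC_atLeast[where F="\<lambda>r. - (U x ^ k / r ^ k)"])
      fix r assume r: "U x \<le> r"
      then have "r > 0" using pos by linarith
      obtain j where j: "k = Suc j" using k gr0_implies_Suc by blast
      have pow: "r * r ^ (n - Suc 0) = r ^ n" if "n > 0" for n
        using that by (cases n) auto
      show "((\<lambda>r. - (U x ^ k / r ^ k)) has_real_derivative real k * U x ^ k / r ^ (k + 1)) (at r)"
        using \<open>r > 0\<close> unfolding j
        by (auto intro!: derivative_eq_intros simp: field_simps pow)
      show "0 \<le> real k * U x ^ k / r ^ (k + 1)" using \<open>r > 0\<close> pos by simp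
    next
      show "((\<lambda>r. - (U x ^ k / r ^ k)) \<longlongrightarrow> 0) at_top"
        using k tendsto_minus[of "\<lambda>r. U x ^ k / r ^ k" 0 at_top]
        by (simp add: real_tendsto_divide_at_top[OF tendsto_const] filterlim_pow_at_top filterlim_ident)
    qed measurable
    finally show ?thesis using pos by simp
  qed
  have "(\<integral>\<^sup>+x. H x \<partial>lborel) = (\<integral>\<^sup>+x. H x * (\<integral>\<^sup>+r. w r x \<partial>lborel) \<partial>lborel)"
    using U_pos by (intro nn_integral_cong_AE) (auto simp: w1 elim: eventually_mono)
  also have "\<dots> = (\<integral>\<^sup>+x. (\<integral>\<^sup>+r. H x * w r x \<partial>lborel) \<partial>lborel)"
    by (intro nn_integral_cong nn_integral_cmult[symmetric]) simp
  also have "\<dots> = (\<integral>\<^sup>+r. (\<integral>\<^sup>+x. H x * w r x \<partial>lborel) \<partial>lborel)"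
    by (rule lborel_pair.Fubini') simp
  \<comment> \<open>Substituting \<open>S r x\<close> for \<open>x\<close> turns the condition
    \<open>U x < r\<close> into \<open>U x < 1\<close>. The Jacobian \<open>r ^ k\<close> combines
    with the weight at \<open>r * U x\<close> to \<open>k * U x ^ k * r ^ (k - 1)\<close>.\<close>
  also have "\<dots> = (\<integral>\<^sup>+r. (\<integral>\<^sup>+x. indicator {x. 0 < U x \<and> U x < 1} x *
      (ennreal (real k * U x ^ k * r ^ (k - 1)) * indicator {0<..} r * H (S r x)) \<partial>lborel) \<partial>lborel)"
  proof (rule nn_integral_cong)
    fix r :: real
    show "(\<integral>\<^sup>+x. H x * w r x \<partial>lborel) = (\<integral>\<^sup>+x. indicator {x. 0 < U x \<and> U x < 1} x *
      (ennreal (real k * U x ^ k * r ^ (k - 1)) * indicator {0<..} r * H (S r x)) \<partial>lborel)"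
    proof (cases "r > 0")
      case r: True
      have "ennreal (r ^ k) * (H (S r x) * w r (S r x)) = indicator {x. 0 < U x \<and> U x < 1} x *
        (ennreal (real k * U x ^ k * r ^ (k - 1)) * indicator {0<..} r * H (S r x))" for x
      proof (cases "0 < U x \<and> U x < 1")
        case True
        obtain j where j: "k = Suc j" using k gr0_implies_Suc by blast
        have "r ^ k * (real k * (r * U x) ^ k / r ^ (k + 1)) = real k * U x ^ k * r ^ (k - 1)"
          using r unfolding j by (simp add: divide_simps power_mult_distrib)
        then have "ennreal (r ^ k) * ennreal (real k * (r * U x) ^ k / r ^ (k + 1)) =
            ennreal (real k * U x ^ k * r ^ (k - 1))"
          using r True by (subst ennreal_mult[symmetric]) auto
        then show ?thesis
          using r True by (simp add: w_def U_S indicator_def mult_ac) (metis mult.assoc mult.commute)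
      next
        case False
        then show ?thesis
          using r by (auto simp: w_def U_S indicator_def zero_less_mult_iff)
      qed
      then show ?thesis
        using scale[OF r, of "\<lambda>x. H x * w r x"] by (simp add: nn_integral_cmult[symmetric])
    next
      case False
      then have "w r x = 0" for x by (auto simp: w_def indicator_def)
      then show ?thesis using False by simp
    qed
  qed
  also have "\<dots> = (\<integral>\<^sup>+x. (\<integral>\<^sup>+r. indicator {x. 0 < U x \<and> U x < 1} x *
      (ennreal (real k * U x ^ k * r ^ (k - 1)) * indicator {0<..} r * H (S r x)) \<partial>lborel) \<partial>lborel)"
    by (rule lborel_pair.Fubini') simp
  also have "\<dots> = (\<integral>\<^sup>+x. indicator {x. 0 < U x \<and> U x < 1} x *
      (\<integral>\<^sup>+r. ennreal (real k * U x ^ k * r ^ (k - 1)) * indicator {0<..} r * H (S r x) \<partial>lborel) \<partial>lborel)"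
    by (intro nn_integral_cong nn_integral_cmult) simp
  \<comment> \<open>Substitution \<open>v = U x * r\<close>: the new variable is the value of
    \<open>U\<close> at the point \<open>S (v / U x) x\<close>, so the orbit is now parametrized by
    \<open>U\<close> itself and no longer by the starting point.\<close>
  also have "\<dots> = (\<integral>\<^sup>+x. indicator {x. 0 < U x \<and> U x < 1} x * (\<integral>\<^sup>+v. ennreal (real k * v ^ (k - 1)) *
       indicator {0<..} v * H (S (v / U x) x) \<partial>lborel) \<partial>lborel)"
  proof (rule nn_integral_cong)
    fix x :: 'a
    show "indicator {x. 0 < U x \<and> U x < 1} x *
      (\<integral>\<^sup>+r. ennreal (real k * U x ^ k * r ^ (k - 1)) * indicator {0<..} r * H (S r x) \<partial>lborel) =
      indicator {x. 0 < U x \<and> U x < 1} x * (\<integral>\<^sup>+v. ennreal (real k * v ^ (k - 1)) *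
       indicator {0<..} v * H (S (v / U x) x) \<partial>lborel)"
    proof (cases "0 < U x")
      case U: True
      obtain j where j: "k = Suc j" using k gr0_implies_Suc by blast
      have *: "ennreal (U x) * (ennreal (real k * (U x * r) ^ (k - 1)) * indicator {0<..} (U x * r) * H (S (U x * r / U x) x))
          = ennreal (real k * U x ^ k * r ^ (k - 1)) * indicator {0<..} r * H (S r x)" for r
      proof (cases "r > 0")
        case True
        have "U x * (real k * (U x * r) ^ (k - 1)) = real k * U x ^ k * r ^ (k - 1)"
          unfolding j by (simp add: power_mult_distrib)
        then have "ennreal (U x) * ennreal (real k * (U x * r) ^ (k - 1)) = ennreal (real k * U x ^ k * r ^ (k - 1))"
          using U True by (subst ennreal_mult[symmetric]) auto
        then show ?thesis using True U by (simp add: mult.assoc[symmetric])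
      next
        case False
        then show ?thesis using U by (simp add: indicator_def zero_less_mult_iff)
      qed
      have "(\<integral>\<^sup>+v. ennreal (real k * v ^ (k - 1)) * indicator {0<..} v * H (S (v / U x) x) \<partial>lborel)
        = (\<integral>\<^sup>+r. ennreal (real k * U x ^ k * r ^ (k - 1)) * indicator {0<..} r * H (S r x) \<partial>lborel)"
      proof (subst nn_integral_real_affine[where c="U x" and t=0])
        show "ennreal \<bar>U x\<bar> * (\<integral>\<^sup>+r. ennreal (real k * (0 + U x * r) ^ (k - 1)) * indicator {0<..} (0 + U x * r) *
            H (S ((0 + U x * r) / U x) x) \<partial>lborel) =
          (\<integral>\<^sup>+r. ennreal (real k * U x ^ k * r ^ (k - 1)) * indicator {0<..} r * H (S r x) \<partial>lborel)"
          unfolding *[symmetric] add_0 using U by (subst nn_integral_cmult) auto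
      qed (use U in auto)
      then show ?thesis by simp
    qed simp
  qed
  finally show ?thesis .
qed

section \<open>The positive definite square root\<close>

lemma inner_matrix_vector_mult:
  fixes M :: "real^'n^'m"
  shows "v \<bullet> (M *v w) = (transpose M *v v) \<bullet> w"
  by (simp add: dot_lmul_matrix)

text \<open>The quadratic form attains its minimum on the compact unit sphere, where it is positive;
  homogeneity of degree 2 carries the bound to all vectors.\<close>

lemma pos_def_mat_lower_bound:
  fixes S :: "real^'p^'p"
  assumes "pos_def_mat S"
  obtains l where "l > 0" "\<And>v. l * (norm v)\<^sup>2 \<le> v \<bullet> (S *v v)"
proof -
  have ne: "sphere (0::real^'p) 1 \<noteq> {}" by simp
  have cont: "continuous_on (sphere 0 1) (\<lambda>v. v \<bullet> (S *v v))"
    by (intro continuous_intros linear_continuous_on) (simp add: linear_conv_bounded_linear[symmetric])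
  obtain w where w: "w \<in> sphere 0 1" and min: "\<And>v. v \<in> sphere 0 1 \<Longrightarrow> w \<bullet> (S *v w) \<le> v \<bullet> (S *v v)"
    using continuous_attains_inf[OF compact_sphere ne cont] by blast
  show thesis
  proof
    have "w \<noteq> 0" using w by auto
    then show "w \<bullet> (S *v w) > 0" using assms by (simp add: pos_def_mat_def)
    fix v :: "real^'p"
    show "w \<bullet> (S *v w) * (norm v)\<^sup>2 \<le> v \<bullet> (S *v v)"
    proof (cases "v = 0")
      case False
      then have "w \<bullet> (S *v w) \<le> (v /\<^sub>R norm v) \<bullet> (S *v (v /\<^sub>R norm v))"
        by (intro min) simp
      also have "\<dots> = (v \<bullet> (S *v v)) / (norm v)\<^sup>2"
        by (simp add: matrix_vector_mult_scaleR power2_eq_square divide_simps)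
      finally show ?thesis using False by (simp add: pos_le_divide_eq)
    qed simp
  qed
qed

text \<open>For small \<open>c\<close>, \<open>A = I - c S\<close> is a strict contraction, so \<open>Y \<mapsto> (A + Y\<^sup>2) / 2\<close> has a fixed point of
  norm less than 1 in the operator norm; then \<open>(I - Y)\<^sup>2 = c S\<close>.\<close>
lemma pos_def_sqrt_exists:
  fixes S :: "real^'p^'p"
  assumes S: "pos_def_mat S"
  shows "\<exists>R. pos_def_mat R \<and> R ** R = S"
proof -
  obtain l where l: "l > 0" "\<And>v. l * (norm v)\<^sup>2 \<le> v \<bullet> (S *v v)"
    using pos_def_mat_lower_bound[OF S] by blast
  obtain K where K: "K > 0" "\<And>v. norm (S *v v) \<le> norm v * K"
    using bounded_linear.pos_bounded[of "(*v) S"] by (auto simp: linear_conv_bounded_linear[symmetric])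
  have Ssym: "v \<bullet> (S *v w) = (S *v v) \<bullet> w" for v w
    using S by (simp add: inner_matrix_vector_mult pos_def_mat_def)
  \<comment> \<open>The square of the norm of \<open>v - c *\<^sub>R (S *v v)\<close> is at most
    \<open>1 - 2 * c * l + c\<^sup>2 * K\<^sup>2\<close> times that of \<open>v\<close>. This choice
    of \<open>c\<close> minimizes the factor, with value \<open>1 - c * l\<close>, whose root is
    \<open>q\<close>.\<close>
  define c where "c = l / K\<^sup>2"
  have c: "c > 0" using l K by (simp add: c_def)
  define q where "q = sqrt (1 - c * l)"
  have ge0: "1 - c * l \<ge> 0 \<and> (\<forall>v. norm (v - c *\<^sub>R (S *v v)) \<le> q * norm v)"
  proof -
    have *: "(norm (v - c *\<^sub>R (S *v v)))\<^sup>2 \<le> (1 - c * l) * (norm v)\<^sup>2" for v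
    proof -
      have "(norm (v - c *\<^sub>R (S *v v)))\<^sup>2 = (norm v)\<^sup>2 - 2 * c * (v \<bullet> (S *v v)) + c\<^sup>2 * (norm (S *v v))\<^sup>2"
        unfolding power2_norm_eq_inner by (simp add: inner_diff_left inner_diff_right inner_commute power2_eq_square algebra_simps)
      also have "\<dots> \<le> (norm v)\<^sup>2 - 2 * c * (l * (norm v)\<^sup>2) + c\<^sup>2 * (norm v * K)\<^sup>2"
        using c l(2)[of v] K(2)[of v]
        by (intro add_mono diff_mono mult_left_mono power_mono) auto
      also have "c\<^sup>2 * (norm v * K)\<^sup>2 = c * l * (norm v)\<^sup>2"
        using K(1) by (simp add: c_def power2_eq_square)
      finally show ?thesis by (simp add: algebra_simps)
    qed
    \<comment> \<open>Any unit vector serves: a square is bounded by the factor, so the factor is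
      nonnegative and \<open>q\<close> is a genuine square root.\<close>
    have "0 \<le> (1 - c * l) * (norm (axis undefined 1 :: real^'p))\<^sup>2"
      using *[of "axis undefined 1"] by (meson order_trans zero_le_power2)
    then have nn: "1 - c * l \<ge> 0" by (simp add: norm_axis_1)
    have "norm (v - c *\<^sub>R (S *v v)) \<le> q * norm v" for v
      using real_le_rsqrt[OF *[of v]] by (simp add: q_def real_sqrt_mult)
    then show ?thesis using nn by blast
  qed
  then have q: "0 \<le> q" "q < 1" using c l(1) by (auto simp: q_def)
  define A where "A = Blinfun (\<lambda>v. v - c *\<^sub>R (S *v v))"
  have blA: "bounded_linear (\<lambda>v. v - c *\<^sub>R (S *v v))"
    by (intro bounded_linear_sub bounded_linear_ident bounded_linear_scaleR_right[THEN bounded_linear_compose])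
      (simp add: linear_conv_bounded_linear[symmetric])
  have A: "blinfun_apply A v = v - c *\<^sub>R (S *v v)" for v
    by (simp add: A_def bounded_linear_Blinfun_apply[OF blA])
  have nA: "norm A \<le> q"
    using ge0 q by (intro norm_blinfun_bound) (auto simp: A)
  \<comment> \<open>Self-adjointness is a closed condition preserved by \<open>F\<close>, so
    building it into the domain makes the fixed point, and hence the root, symmetric. The ball is
    preserved because \<open>(q + q * q) / 2\<close> \<le> \<open>q\<close>.\<close>
  define D where "D = cball (0 :: (real^'p) \<Rightarrow>\<^sub>L (real^'p)) q \<inter>
    (\<Inter>v w. {Y. v \<bullet> blinfun_apply Y w = blinfun_apply Y v \<bullet> w})"
  define F where "F Y = (1/2) *\<^sub>R (A + (Y o\<^sub>L Y))" for Y
  have nF: "norm ((Y o\<^sub>L Y) - (Z o\<^sub>L Z)) \<le> 2 * q * norm (Y - Z)" if "norm Y \<le> q" "norm Z \<le> q" for Y Z :: "(real^'p) \<Rightarrow>\<^sub>L (real^'p)"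
  proof -
    \<comment> \<open>This splitting of the difference of squares is valid for operators that do not
      commute. On the ball it gives the factor \<open>2 * q\<close>, and the 1/2 in \<open>F\<close>
      reduces this to the contraction constant \<open>q\<close>.\<close>
    have "(Y o\<^sub>L Y) - (Z o\<^sub>L Z) = (Y o\<^sub>L (Y - Z)) + ((Y - Z) o\<^sub>L Z)"
      by (rule blinfun_eqI) (simp add: blinfun.bilinear_simps)
    also have "norm \<dots> \<le> norm Y * norm (Y - Z) + norm (Y - Z) * norm Z"
      by (intro norm_triangle_le add_mono norm_blinfun_compose)
    also have "\<dots> \<le> q * norm (Y - Z) + norm (Y - Z) * q"
      using that q by (intro add_mono mult_mono) auto
    finally show ?thesis by simp
  qed
  have "\<exists>!Y. Y \<in> D \<and> F Y = Y"
  proof (rule Banach_fix)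
    show "complete D" unfolding D_def
      by (intro complete_eq_closed[THEN iffD2] closed_Int closed_INT closed_cball ballI closed_Collect_eq continuous_intros)
    have "0 \<in> D" using q by (simp add: D_def)
    then show "D \<noteq> {}" by blast
    show "F ` D \<subseteq> D"
    proof
      fix Z assume "Z \<in> F ` D"
      then obtain Y where Y: "Y \<in> D" and Z: "Z = F Y" by blast
      have nY: "norm Y \<le> q" and sY: "\<And>v w. v \<bullet> blinfun_apply Y w = blinfun_apply Y v \<bullet> w"
        using Y by (auto simp: D_def)
      have "norm (A + (Y o\<^sub>L Y)) \<le> q + q * q"
        using nA nY q norm_blinfun_compose[of Y Y]
          mult_mono[OF nY nY q(1) norm_ge_zero]
        by (intro norm_triangle_le add_mono) linarith+
      also have "\<dots> \<le> 2 * q" using q by (simp add: mult_left_le)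
      finally have "norm Z \<le> q" by (simp add: Z F_def)
      moreover have "v \<bullet> blinfun_apply Z w = blinfun_apply Z v \<bullet> w" for v w
        using sY[of v "blinfun_apply Y w"] sY[of "blinfun_apply Y v" w]
        by (simp add: Z F_def blinfun.bilinear_simps A inner_diff_left inner_diff_right inner_add_left inner_add_right Ssym)
      ultimately show "Z \<in> D" by (simp add: D_def)
    qed
    fix Y Z assume "Y \<in> D" "Z \<in> D"
    then have "norm Y \<le> q" "norm Z \<le> q" by (auto simp: D_def)
    moreover have "F Y - F Z = (1/2) *\<^sub>R ((Y o\<^sub>L Y) - (Z o\<^sub>L Z))" by (simp add: F_def algebra_simps)
    ultimately show "dist (F Y) (F Z) \<le> q * dist Y Z"
      using nF[of Y Z] by (simp add: dist_norm)
  qed (use q in auto)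
  then obtain Y where YD: "Y \<in> D" and FY: "F Y = Y" by blast
  have nY: "norm Y \<le> q" and sY: "\<And>v w. v \<bullet> blinfun_apply Y w = blinfun_apply Y v \<bullet> w"
    using YD by (auto simp: D_def)
  have fix_eq: "2 *\<^sub>R blinfun_apply Y v = v - c *\<^sub>R (S *v v) + blinfun_apply Y (blinfun_apply Y v)" for v
  proof -
    have "2 *\<^sub>R Y = A + (Y o\<^sub>L Y)" by (subst FY[symmetric]) (simp add: F_def)
    then have "blinfun_apply (2 *\<^sub>R Y) v = blinfun_apply (A + (Y o\<^sub>L Y)) v" by simp
    then show ?thesis by (simp add: blinfun.bilinear_simps A)
  qed
  define R where "R = (1 / sqrt c) *\<^sub>R matrix (\<lambda>v. v - blinfun_apply Y v)"
  have lin: "linear (\<lambda>v. v - blinfun_apply Y v)"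
    by (intro linear_compose_sub linear_ident bounded_linear.linear[OF blinfun.bounded_linear_right])
  have R: "R *v v = (1 / sqrt c) *\<^sub>R (v - blinfun_apply Y v)" for v
    by (simp add: R_def scaleR_matrix_vector_assoc[symmetric] matrix_vector_mul(2)[OF lin])
  have "R *v (R *v v) = S *v v" for v
  proof -
    have "R *v (R *v v) = (1 / sqrt c * (1 / sqrt c)) *\<^sub>R
        (v - blinfun_apply Y v - (blinfun_apply Y v - blinfun_apply Y (blinfun_apply Y v)))"
      by (simp only: R blinfun.scaleR_right blinfun.diff_right scaleR_diff_right[symmetric] scaleR_scaleR)
    also have "v - blinfun_apply Y v - (blinfun_apply Y v - blinfun_apply Y (blinfun_apply Y v)) = c *\<^sub>R (S *v v)"
      using fix_eq[of v] unfolding scaleR_2 by (simp add: diff_eq_eq eq_diff_eq ac_simps)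
    finally show ?thesis using c by simp
  qed
  then have "R ** R = S" by (simp add: matrix_eq matrix_vector_mul_assoc[symmetric])
  moreover have "pos_def_mat R"
    unfolding pos_def_mat_def
  proof (intro conjI allI impI)
    have "v \<bullet> (R *v w) = (R *v v) \<bullet> w" for v w
      by (simp add: R inner_diff_left inner_diff_right sY)
    then have "(transpose R *v v) \<bullet> w = (R *v v) \<bullet> w" for v w
      by (simp only: inner_matrix_vector_mult)
    then show "transpose R = R" by (metis matrix_eq vector_eq_rdot)
    fix v :: "real^'p" assume v: "v \<noteq> 0"
    \<comment> \<open>Since \<open>norm Y\<close> \<le> \<open>q\<close> < 1, the form of
      \<open>Y\<close> stays strictly below that of the identity, so \<open>I - Y\<close> is
      positive definite.\<close>
    have "v \<bullet> blinfun_apply Y v \<le> norm v * norm (blinfun_apply Y v)" by (rule norm_cauchy_schwarz)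
    also have "\<dots> \<le> norm v * (q * norm v)"
      using norm_blinfun[of Y v] mult_right_mono[OF nY norm_ge_zero[of v]]
      by (intro mult_left_mono norm_ge_zero) linarith
    also have "\<dots> < v \<bullet> v" using q v
      by (simp add: dot_square_norm power2_eq_square)
    finally show "0 < v \<bullet> (R *v v)" using c by (simp add: R inner_diff_right)
  qed
  ultimately show ?thesis by blast
qed

text \<open>\<open>D = R - Q\<close> satisfies \<open>R D + D Q = 0\<close>; multiplying by \<open>D\<close> and taking traces gives two
  nonnegative terms with sum 0.\<close>
lemma pos_def_sqrt_unique:
  fixes R Q :: "real^'p^'p"
  assumes R: "pos_def_mat R" and Q: "psd_mat Q" and eq: "Q ** Q = R ** R"
  shows "Q = R"
proof -
  define D where "D = R - Q"
  have sym: "transpose D = D" using R Q by (simp add: D_def pos_def_mat_def psd_mat_def transpose_def vec_eq_iff)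
  have D_sym: "v \<bullet> (D *v w) = (D *v v) \<bullet> w" for v w
    by (simp add: inner_matrix_vector_mult sym)
  have syl: "R ** D + D ** Q = 0"
    using eq by (simp add: D_def matrix_eq matrix_vector_mul_assoc[symmetric] matrix_vector_mult_add_rdistrib
      matrix_vector_mult_diff_distrib matrix_vector_mult_diff_rdistrib)
  have "trace (D ** (R ** D)) + trace (D ** (D ** Q)) = trace (D ** (R ** D + D ** Q))"
    by (simp only: matrix_add_ldistrib trace_add)
  also have "\<dots> = 0" by (simp add: syl trace_def)
  \<comment> \<open>Cyclicity of the trace moves one \<open>D\<close> to the other side of
    \<open>Q\<close>. Both terms now have the shape \<open>D M D\<close>, whose trace is the sum of
    the form of \<open>M\<close> over the columns of the symmetric matrix \<open>D\<close>.\<close>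
  also have "trace (D ** (D ** Q)) = trace (D ** (Q ** D))"
    using trace_mul_sym[of D "D ** Q"] by (simp only: matrix_mul_assoc)
  finally have tr: "trace (D ** (R ** D)) + trace (D ** (Q ** D)) = 0" .
  have tr_eq: "trace (D ** (M ** D)) = (\<Sum>i\<in>UNIV. (D *v axis i 1) \<bullet> (M *v (D *v axis i 1)))" for M
  proof -
    have "(D ** (M ** D)) $ i $ i = (D *v axis i 1) \<bullet> (M *v (D *v axis i 1))" for i
    proof -
      have "(D ** (M ** D)) $ i $ i = axis i 1 \<bullet> ((D ** (M ** D)) *v axis i 1)"
        by (simp add: inner_axis' matrix_vector_mult_basis column_def)
      then show ?thesis by (simp add: matrix_vector_mul_assoc[symmetric] D_sym)
    qed
    then show ?thesis by (simp add: trace_def)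
  qed
  have nnR: "0 \<le> v \<bullet> (R *v v)" for v using R by (cases "v = 0") (auto simp: pos_def_mat_def less_imp_le)
  have "trace (D ** (Q ** D)) \<ge> 0"
    unfolding tr_eq using Q by (intro sum_nonneg) (auto simp: psd_mat_def)
  moreover have "trace (D ** (R ** D)) \<ge> 0"
    unfolding tr_eq using nnR by (intro sum_nonneg) auto
  ultimately have "trace (D ** (R ** D)) = 0" using tr by linarith
  then have "(D *v axis i 1) \<bullet> (R *v (D *v axis i 1)) = 0" for i
    unfolding tr_eq using nnR by (simp add: sum_nonneg_eq_0_iff)
  then have "D *v axis i 1 = 0" for i
    using R by (metis less_irrefl pos_def_mat_def)
  then have "D = 0"
    by (simp add: matrix_vector_mult_basis column_def vec_eq_iff)
  then show ?thesis by (simp add: D_def)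
qed

lemma pos_def_mat_imp_psd_mat: "pos_def_mat R \<Longrightarrow> psd_mat R"
  unfolding pos_def_mat_def psd_mat_def
proof (elim conjE, intro conjI allI)
  fix v assume "\<forall>v. v \<noteq> 0 \<longrightarrow> 0 < v \<bullet> (R *v v)"
  then show "0 \<le> v \<bullet> (R *v v)" by (cases "v = 0") (auto simp: less_imp_le)
qed

text \<open>Discharges the definite description: the positive definite root from the fixed point
  argument is itself a positive semidefinite root and excludes every other one.\<close>

lemma msqrt_pos_def:
  fixes S :: "real^'p^'p"
  assumes "pos_def_mat S"
  shows "pos_def_mat (msqrt S)" "msqrt S ** msqrt S = S"
proof -
  obtain R where R: "pos_def_mat R" "R ** R = S" using pos_def_sqrt_exists[OF assms] by blast
  have "msqrt S = R"
    unfolding msqrt_def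
  proof (rule the_equality)
    show "psd_mat R \<and> R ** R = S" using R pos_def_mat_imp_psd_mat by blast
    fix Q assume "psd_mat Q \<and> Q ** Q = S"
    then show "Q = R" using pos_def_sqrt_unique[OF R(1), of Q] R(2) by simp
  qed
  then show "pos_def_mat (msqrt S)" "msqrt S ** msqrt S = S" using R by simp_all
qed

text \<open>\<open>matrix_inv\<close> is a Hilbert choice; for square matrices a one-sided inverse
  is two-sided and unique, so the choice is forced.\<close>

lemma matrix_inv_eqI:
  fixes A B :: "real^'p^'p"
  assumes "A ** B = mat 1"
  shows "matrix_inv A = B"
proof -
  have BA: "B ** A = mat 1" using assms by (simp add: matrix_left_right_inverse)
  show ?thesis
    unfolding matrix_inv_def
  proof (rule some_equality)
    show "A ** B = mat 1 \<and> B ** A = mat 1" using assms BA by simp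
    fix C assume "A ** C = mat 1 \<and> C ** A = mat 1"
    then show "C = B"
      using BA matrix_mul_assoc[of B A C] by simp
  qed
qed

lemma minvsqrt_pos_def:
  fixes S :: "real^'p^'p"
  assumes "pos_def_mat S"
  shows "minvsqrt S ** msqrt S = mat 1" "msqrt S ** minvsqrt S = mat 1"
    "transpose (minvsqrt S) = minvsqrt S" "matrix_inv S = minvsqrt S ** minvsqrt S"
proof -
  note R = msqrt_pos_def[OF assms]
  have "\<forall>v. msqrt S *v v = 0 \<longrightarrow> v = 0"
    using R(1) unfolding pos_def_mat_def by (metis inner_zero_right less_irrefl)
  then obtain B where B: "B ** msqrt S = mat 1"
    using matrix_left_invertible_ker by blast
  then have B': "msqrt S ** B = mat 1" by (simp add: matrix_left_right_inverse)
  have inv: "minvsqrt S = B" unfolding minvsqrt_def by (rule matrix_inv_eqI[OF B'])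
  have "transpose B ** msqrt S = mat 1"
    using arg_cong[OF B', of transpose] R(1) by (simp add: matrix_transpose_mul pos_def_mat_def)
  then have tB: "transpose B = B"
    using B' matrix_mul_assoc[of "transpose B" "msqrt S" B] by simp
  have "S ** (B ** B) = mat 1"
  proof -
    have "S ** (B ** B) = msqrt S ** (msqrt S ** B) ** B"
      using R(2) by (simp add: matrix_mul_assoc)
    then show ?thesis using B' by simp
  qed
  then have "matrix_inv S = B ** B" by (rule matrix_inv_eqI)
  with B B' inv tB show "minvsqrt S ** msqrt S = mat 1" "msqrt S ** minvsqrt S = mat 1"
    "transpose (minvsqrt S) = minvsqrt S" "matrix_inv S = minvsqrt S ** minvsqrt S" by auto
qed

section \<open>Partitions and merge probabilities\<close>

lemma partition_on_merge_part:
  assumes P: "partition_on UNIV P" and M: "M \<in> candidates P"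
  shows "partition_on UNIV (merge_part P M)"
proof -
  have MP: "M \<subseteq> P" and "M \<noteq> {}" using M by (auto simp: candidates_def)
  have dj: "A \<inter> B = {}" if "A \<in> P" "B \<in> P" "A \<noteq> B" for A B
    using partition_onD2[OF P] that by (simp add: disjoint_def)
  have dM: "A \<inter> \<Union> M = {}" if "A \<in> P - M" for A
    using dj[of A] that MP by blast
  have "{} \<notin> P" using partition_onD3[OF P] by simp
  moreover obtain A where "A \<in> M" using \<open>M \<noteq> {}\<close> by blast
  ultimately have "\<Union> M \<noteq> {}" using MP by (metis Union_empty_conv subsetD)
  have "disjoint (P - M \<union> {\<Union> M})"
    unfolding disjoint_def
  proof (intro ballI impI)
    fix A B assume "A \<in> P - M \<union> {\<Union> M}" "B \<in> P - M \<union> {\<Union> M}" "A \<noteq> B"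
    then consider "A \<in> P" "B \<in> P" | "A \<in> P - M" "B = \<Union> M" | "B \<in> P - M" "A = \<Union> M"
      by blast
    then show "A \<inter> B = {}"
      using dj[of A B] dM[of A] dM[of B] \<open>A \<noteq> B\<close> by cases (simp_all add: Int_commute)
  qed
  moreover have "\<Union> (P - M \<union> {\<Union> M}) = UNIV"
  proof -
    have "\<Union> (P - M \<union> {\<Union> M}) = \<Union> P" using MP by (simp flip: Union_Un_distrib add: Un_absorb1 Un_absorb2)
    then show ?thesis using partition_onD1[OF P] by simp
  qed
  ultimately show ?thesis
    unfolding merge_part_def partition_on_def using \<open>{} \<notin> P\<close> \<open>\<Union> M \<noteq> {}\<close> by simp
qed

lemma partition_on_part_after:
  assumes "valid_merges ms" "s \<le> length ms"
  shows "partition_on UNIV (part_after ms s)"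
  using assms(2)
proof (induction s)
  case 0
  show ?case
    by (auto simp: part_after_def init_part_def partition_on_def disjoint_def)
next
  case (Suc s)
  have "part_after ms (Suc s) = merge_part (part_after ms s) (ms ! s)"
    using Suc.prems by (simp add: part_after_def take_Suc_conv_app_nth)
  moreover have "ms ! s \<in> candidates (part_after ms s)"
    using assms(1) Suc.prems by (simp add: valid_merges_def)
  ultimately show ?case using Suc partition_on_merge_part by fastforce
qed

text \<open>The last merge is a candidate of a partition: cardinality 2 forces the clusters to be
  distinct, and distinct cells of a partition are nonempty and disjoint.\<close>

lemma merge_clusters:
  assumes "valid_merges ms" "ms \<noteq> []" "last ms = {C1, C2}"
  shows "C1 \<noteq> {}" "C2 \<noteq> {}" "C1 \<inter> C2 = {}"
proof -
  \<comment> \<open>Merges are indexed from 0 and \<open>part_after ms s\<close> is the state before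
    merge \<open>s\<close>, so this is the state from which the last merge is drawn.\<close>
  let ?P = "part_after ms (length ms - 1)"
  have P: "partition_on UNIV ?P" by (rule partition_on_part_after[OF assms(1)]) simp
  have "{C1, C2} \<in> candidates ?P"
    using assms by (metis valid_merges_def last_conv_nth diff_less length_greater_0_conv zero_less_one)
  then have C: "C1 \<in> ?P" "C2 \<in> ?P" "C1 \<noteq> C2"
    by (auto simp: candidates_def card_insert_if split: if_splits)
  show "C1 \<noteq> {}" "C2 \<noteq> {}" using partition_onD3[OF P] C by auto
  show "C1 \<inter> C2 = {}" using partition_onD2[OF P] C by (auto simp: disjoint_def)
qed

lemma contrast_nonzero:
  fixes C1 C2 :: "'n::finite set"
  assumes "C1 \<noteq> {}" "C1 \<inter> C2 = {}"
  shows "contrast C1 C2 \<noteq> 0"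
proof -
  obtain i where i: "i \<in> C1" using assms(1) by blast
  then have "contrast C1 C2 $ i = 1 / real (card C1)" using assms(2) by (auto simp: contrast_def)
  moreover have "card C1 > 0" using i by (simp add: card_gt_0_iff) blast
  ultimately show ?thesis by (metis zero_index divide_eq_0_iff of_nat_0_less_iff less_irrefl zero_neq_one)
qed

text \<open>The left side is \<open>transpose \<mu> *v \<nu>\<close> written by rows. This is how
  equality of the cluster means becomes orthogonality of \<open>\<nu>\<close> to the columns of
  \<open>\<mu>\<close>.\<close>

lemma sum_contrast_scaleR:
  fixes \<mu> :: "real^'p^'n"
  shows "(\<Sum>i\<in>UNIV. contrast C1 C2 $ i *\<^sub>R \<mu> $ i) = mean_row \<mu> C1 - mean_row \<mu> C2"
proof -
  have "contrast C1 C2 $ i *\<^sub>R \<mu> $ i = (if i \<in> C1 then (1 / real (card C1)) *\<^sub>R \<mu> $ i else 0)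
      - (if i \<in> C2 then (1 / real (card C2)) *\<^sub>R \<mu> $ i else 0)" for i
    by (simp add: contrast_def scaleR_diff_left)
  then show ?thesis
    by (simp add: sum_subtractf mean_row_def scaleR_sum_right sum.If_cases)
qed

section \<open>Measurability and bounds of the path probability\<close>

lemma borel_measurable_merge_prob:
  assumes [measurable]: "\<And>M. d M \<in> borel_measurable borel"
  shows "merge_prob \<tau> d P M \<in> borel_measurable borel"
  unfolding merge_prob_def[abs_def] temp_def by measurable

lemma borel_measurable_path_prob:
  assumes [measurable]: "\<And>M. d M \<in> borel_measurable borel"
  shows "path_prob \<tau> d ms \<in> borel_measurable borel"
  unfolding path_prob_def[abs_def] 
  by (intro borel_measurable_prod borel_measurable_merge_prob assms)

lemma merge_prob_bounds:
  fixes P :: "'n::finite set set"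
  assumes "M \<in> candidates P"
  shows "0 < merge_prob \<tau> d P M x" "merge_prob \<tau> d P M x \<le> 1"
proof -
  let ?e = "\<lambda>M. exp (- d M x / temp \<tau> d P x)"
  have "?e M \<le> (\<Sum>M'\<in>candidates P. ?e M')"
    using assms by (intro member_le_sum) (auto simp: candidates_def)
  moreover from this have "0 < (\<Sum>M'\<in>candidates P. ?e M')"
    by (rule less_le_trans[OF exp_gt_zero])
  ultimately show "0 < merge_prob \<tau> d P M x" "merge_prob \<tau> d P M x \<le> 1"
    unfolding merge_prob_def by simp_all
qed

text \<open>Each factor is a softmax weight, one of the positive summands divided by their sum. The
  upper bound later gives integrability along orbits, strict positivity a nonzero denominator of
  \<open>cond_cdf\<close>.\<close>

lemma path_prob_bounds:
  fixes ms :: "'n::finite set set list"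
  assumes "valid_merges ms"
  shows "0 < path_prob \<tau> d ms x" "path_prob \<tau> d ms x \<le> 1"
proof -
  have "0 < merge_prob \<tau> d (part_after ms s) (ms ! s) x \<and> merge_prob \<tau> d (part_after ms s) (ms ! s) x \<le> 1"
    if "s < length ms" for s
  proof -
    have "ms ! s \<in> candidates (part_after ms s)" using assms that by (simp add: valid_merges_def)
    from merge_prob_bounds[OF this, of \<tau> d x] show ?thesis by (rule conjI)
  qed
  then have pos: "0 < merge_prob \<tau> d (part_after ms s) (ms ! s) x"
    and le: "merge_prob \<tau> d (part_after ms s) (ms ! s) x \<le> 1" if "s < length ms" for s
    using that by blast+
  show "0 < path_prob \<tau> d ms x"
    unfolding path_prob_def by (rule prod_pos) (rule pos, simp)
  show "path_prob \<tau> d ms x \<le> 1"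
    unfolding path_prob_def by (rule prod_le_1) (use pos le in \<open>auto intro: less_imp_le\<close>)
qed

section \<open>The chi density\<close>

text \<open>Only the shape in \<open>v\<close> has to match the orbit density; the normalizing
  constant \<open>K\<close> cancels in the quotient \<open>cond_cdf\<close>.\<close>

lemma scaled_chi_density_eq:
  assumes "c > 0" "k > 0"
  obtains K where "K > 0"
    "\<And>v. v \<ge> 0 \<Longrightarrow> scaled_chi_density c k v = K * (v ^ (k - 1) * exp (- v\<^sup>2 / (2 * c\<^sup>2)))"
proof
  let ?N = "2 powr (real k / 2 - 1) * Gamma (real k / 2)"
  have "Gamma (real k / 2) > 0" using assms by (intro Gamma_real_pos) simp
  then show "0 < 1 / (c ^ (k - 1) * ?N * c)" using assms by simp
  show "scaled_chi_density c k v = 1 / (c ^ (k - 1) * ?N * c) * (v ^ (k - 1) * exp (- v\<^sup>2 / (2 * c\<^sup>2)))"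
    if "v \<ge> 0" for v
    using assms that by (simp add: scaled_chi_density_def chi_density_def power_divide mult_ac)
qed

lemma nn_integral_power_gaussian_finite:
  assumes "c > 0"
  shows "(\<integral>\<^sup>+v. ennreal (v ^ k * exp (- v\<^sup>2 / (2 * c\<^sup>2))) * indicator {0..} v \<partial>lborel) < \<infinity>"
proof -
  let ?f = "\<lambda>v. ennreal (v ^ k * exp (- v\<^sup>2 / (2 * c\<^sup>2))) * indicator {0..} v"
  let ?g = "\<lambda>v. ennreal (v ^ k * exp (- v)) * indicator {0..} v"
  have "(\<integral>\<^sup>+v. ?f v \<partial>lborel) = ennreal c * (\<integral>\<^sup>+v. ?f (0 + c * v) \<partial>lborel)"
    using assms by (subst nn_integral_real_affine[where c=c and t=0]) auto
  moreover have "(\<integral>\<^sup>+v. ?f (0 + c * v) \<partial>lborel) \<le> (\<integral>\<^sup>+v. ennreal (c ^ k * exp (1/2)) * ?g v \<partial>lborel)"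
  proof (rule nn_integral_mono)
    fix v :: real
    show "?f (0 + c * v) \<le> ennreal (c ^ k * exp (1/2)) * ?g v"
    proof (cases "v \<ge> 0")
      case True
      have "- ((c * v)\<^sup>2 / (2 * c\<^sup>2)) = - (v\<^sup>2 / 2)" using assms by (simp add: power_mult_distrib)
      \<comment> \<open>Equivalent to \<open>(v - 1)\<^sup>2\<close> \<ge> 0. It replaces the
        Gaussian tail by an exponential one, whose moments are factorials.\<close>
      moreover have "- (v\<^sup>2 / 2) \<le> 1/2 - v"
        using zero_le_power2[of "v - 1"] by (simp add: power2_eq_square algebra_simps)
      ultimately have "exp (- ((c * v)\<^sup>2 / (2 * c\<^sup>2))) \<le> exp (1/2) * exp (- v)"
        by (simp add: exp_add[symmetric])
      then have "(c * v) ^ k * exp (- ((c * v)\<^sup>2 / (2 * c\<^sup>2))) \<le> (c ^ k * v ^ k) * (exp (1/2) * exp (- v))"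
        using True assms unfolding power_mult_distrib[of c v k] by (intro mult_left_mono) auto
      then show ?thesis
        using True assms by (simp add: ennreal_mult[symmetric] mult_ac)
    next
      case False
      then show ?thesis using assms by (simp add: indicator_def zero_le_mult_iff)
    qed
  qed
  moreover have "(\<integral>\<^sup>+v. ennreal (c ^ k * exp (1/2)) * ?g v \<partial>lborel) = ennreal (c ^ k * exp (1/2)) * ennreal (fact k)"
    by (subst nn_integral_cmult) (auto simp: nn_intergal_power_times_exp_Ici)
  moreover have "ennreal (c ^ k * exp (1/2)) * ennreal (fact k) < top"
    by (simp add: ennreal_mult_less_top)
  ultimately show ?thesis
    by (simp add: ennreal_mult_less_top le_less_trans)
qed

section \<open>The test statistics along an orbit\<close>

lemma transpose_matrix_vector_mult_eq_sum:
  fixes x :: "real^'p^'n"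
  shows "transpose x *v \<nu> = (\<Sum>i\<in>UNIV. \<nu> $ i *\<^sub>R x $ i)"
  by (simp add: vec_eq_iff vector_matrix_mult_def mult.commute)

lemma sum_squares_eq_norm: "(\<Sum>i\<in>UNIV. \<nu> $ i * \<nu> $ i) = (norm (\<nu> :: real^'n))\<^sup>2"
  by (simp add: power2_norm_eq_inner inner_vec_def)

lemma X_of_row:
  assumes "pos_def_mat \<Sigma>"
  shows "X_of \<Sigma> \<nu> u a $ i = (u * \<nu> $ i / (norm \<nu>)\<^sup>2) *\<^sub>R (msqrt \<Sigma> *v fst a) + snd a $ i"
proof -
  have "fst a v* msqrt \<Sigma> = msqrt \<Sigma> *v fst a"
    using msqrt_pos_def(1)[OF assms] transpose_matrix_vector[of "msqrt \<Sigma>" "fst a"]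
    by (simp add: pos_def_mat_def)
  then show ?thesis by (simp add: X_of_def vec_eq_iff)
qed

lemma snd_stat_A_row:
  fixes x :: "real^'p^'n"
  shows "snd (stat_A \<Sigma> \<nu> x) $ i = x $ i - (\<nu> $ i / (norm \<nu>)\<^sup>2) *\<^sub>R (transpose x *v \<nu>)"
proof -
  let ?P = "\<chi> i j. \<nu> $ i * \<nu> $ j"
  have "(mat 1 - (1 / (norm \<nu>)\<^sup>2) *\<^sub>R ?P) ** x = x - (1 / (norm \<nu>)\<^sup>2) *\<^sub>R (?P ** x)"
    by (simp add: matrix_eq matrix_vector_mul_assoc[symmetric] matrix_vector_mult_diff_rdistrib
        scaleR_matrix_vector_assoc[symmetric])
  moreover have "(?P ** x) $ i = \<nu> $ i *\<^sub>R (transpose x *v \<nu>)"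
    by (simp add: vec_eq_iff matrix_matrix_mult_def transpose_matrix_vector_mult_eq_sum
        sum_distrib_left mult.assoc del: transpose_matrix_vector)
  ultimately show ?thesis by (simp add: stat_A_def del: transpose_matrix_vector)
qed

text \<open>The conditions on \<open>a\<close> describe values of \<open>stat_A\<close> at points
  with \<open>stat_U\<close> > 0. Under them \<open>\<nu>\<close> annihilates the residual part of
  \<open>X_of\<close> and only \<open>u\<close> times the whitened direction survives, so
  \<open>X_of\<close> parametrizes the fiber of \<open>stat_A\<close> over \<open>a\<close> by
  \<open>stat_U\<close>.\<close>

lemma stat_X_of:
  fixes \<nu> :: "real^'n" and \<Sigma> :: "real^'p^'p"
  assumes S: "pos_def_mat \<Sigma>" and \<nu>: "\<nu> \<noteq> 0"
    and a: "norm (fst a) = 1" "transpose (snd a) *v \<nu> = 0" and u: "u > 0"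
  shows "stat_U \<Sigma> \<nu> (X_of \<Sigma> \<nu> u a) = u" "stat_A \<Sigma> \<nu> (X_of \<Sigma> \<nu> u a) = a"
proof -
  note [simp del] = transpose_matrix_vector
  have c: "norm \<nu> > 0" using \<nu> by simp
  have "transpose (X_of \<Sigma> \<nu> u a) *v \<nu> = (\<Sum>i\<in>UNIV. (\<nu> $ i * \<nu> $ i * (u / (norm \<nu>)\<^sup>2)) *\<^sub>R (msqrt \<Sigma> *v fst a))
      + transpose (snd a) *v \<nu>"
    unfolding transpose_matrix_vector_mult_eq_sum
    by (simp add: X_of_row[OF S] scaleR_add_right sum.distrib mult_ac)
  also have "\<dots> = u *\<^sub>R (msqrt \<Sigma> *v fst a)"
    using c unfolding scaleR_sum_left[symmetric] sum_distrib_right[symmetric] sum_squares_eq_norm by (simp add: a)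
  finally have w: "transpose (X_of \<Sigma> \<nu> u a) *v \<nu> = u *\<^sub>R (msqrt \<Sigma> *v fst a)" .
  have Ww: "minvsqrt \<Sigma> *v (transpose (X_of \<Sigma> \<nu> u a) *v \<nu>) = u *\<^sub>R fst a"
    unfolding w by (simp add: matrix_vector_mult_scaleR matrix_vector_mul_assoc minvsqrt_pos_def(1)[OF S])
  show "stat_U \<Sigma> \<nu> (X_of \<Sigma> \<nu> u a) = u" using a u by (simp add: stat_U_def Ww)
  show "stat_A \<Sigma> \<nu> (X_of \<Sigma> \<nu> u a) = a"
  proof (rule prod_eqI)
    show "fst (stat_A \<Sigma> \<nu> (X_of \<Sigma> \<nu> u a)) = fst a" using a u by (simp add: stat_A_def Ww)
    have "snd (stat_A \<Sigma> \<nu> (X_of \<Sigma> \<nu> u a)) $ i = snd a $ i" for i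
      unfolding snd_stat_A_row X_of_row[OF S] w by (simp add: mult.commute)
    then show "snd (stat_A \<Sigma> \<nu> (X_of \<Sigma> \<nu> u a)) = snd a" by (simp add: vec_eq_iff)
  qed
qed

text \<open>Positivity of \<open>stat_U\<close> matters: at \<open>stat_U\<close> = 0 the division
  by zero would make the first component 0 and not a unit vector.\<close>

lemma stat_A_range:
  fixes \<nu> :: "real^'n" and \<Sigma> :: "real^'p^'p"
  assumes \<nu>: "\<nu> \<noteq> 0" and U: "stat_U \<Sigma> \<nu> x > 0"
  shows "norm (fst (stat_A \<Sigma> \<nu> x)) = 1" "transpose (snd (stat_A \<Sigma> \<nu> x)) *v \<nu> = 0"
proof -
  note [simp del] = transpose_matrix_vector
  show "norm (fst (stat_A \<Sigma> \<nu> x)) = 1" using U by (simp add: stat_A_def stat_U_def)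
  have "transpose (snd (stat_A \<Sigma> \<nu> x)) *v \<nu> =
      transpose x *v \<nu> - (\<Sum>i\<in>UNIV. (\<nu> $ i * \<nu> $ i * (1 / (norm \<nu>)\<^sup>2)) *\<^sub>R (transpose x *v \<nu>))"
    unfolding transpose_matrix_vector_mult_eq_sum[of "snd (stat_A \<Sigma> \<nu> x)"]
    by (simp add: snd_stat_A_row scaleR_diff_right sum_subtractf transpose_matrix_vector_mult_eq_sum[of x])
  also have "\<dots> = 0"
    using \<nu> unfolding scaleR_sum_left[symmetric] sum_distrib_right[symmetric] sum_squares_eq_norm by simp
  finally show "transpose (snd (stat_A \<Sigma> \<nu> x)) *v \<nu> = 0" .
qed

text \<open>The added term is \<open>r - 1\<close> times the orthogonal projection of the columns of
  \<open>x\<close> onto the line of \<open>\<nu>\<close>. The formula does not contain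
  \<open>\<Sigma>\<close>: scaling by \<open>r\<close> commutes with whitening, so the Jacobian can
  be computed without it.\<close>

definition dilate :: "real^'n \<Rightarrow> real \<Rightarrow> real^'p^'n \<Rightarrow> real^'p^'n" where
  "dilate \<nu> r x = (\<chi> i. x $ i + ((r - 1) * \<nu> $ i / (norm \<nu>)\<^sup>2) *\<^sub>R (transpose x *v \<nu>))"

lemma transpose_dilate:
  assumes "\<nu> \<noteq> 0"
  shows "transpose (dilate \<nu> r x) *v \<nu> = r *\<^sub>R (transpose x *v \<nu>)"
proof -
  note [simp del] = transpose_matrix_vector
  have "transpose (dilate \<nu> r x) *v \<nu> = transpose x *v \<nu>
      + (\<Sum>i\<in>UNIV. (\<nu> $ i * \<nu> $ i * ((r - 1) / (norm \<nu>)\<^sup>2)) *\<^sub>R (transpose x *v \<nu>))"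
    unfolding transpose_matrix_vector_mult_eq_sum[of "dilate \<nu> r x"]
    by (simp add: dilate_def scaleR_add_right sum.distrib transpose_matrix_vector_mult_eq_sum[of x] mult_ac)
  also have "\<dots> = r *\<^sub>R (transpose x *v \<nu>)"
    using assms unfolding scaleR_sum_left[symmetric] sum_distrib_right[symmetric] sum_squares_eq_norm
    by (simp add: scaleR_diff_left)
  finally show ?thesis .
qed

lemma stat_U_dilate:
  assumes "\<nu> \<noteq> 0" "r > 0"
  shows "stat_U \<Sigma> \<nu> (dilate \<nu> r x) = r * stat_U \<Sigma> \<nu> x"
  using assms by (simp add: stat_U_def transpose_dilate matrix_vector_mult_scaleR del: transpose_matrix_vector)

text \<open>\<open>msqrt \<Sigma>\<close> undoes the whitening inside the direction, so both sides
  are the residual part plus the projection of \<open>x\<close> rescaled by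
  \<open>v / stat_U \<Sigma> \<nu> x\<close>.\<close>

lemma dilate_eq_X_of:
  assumes S: "pos_def_mat \<Sigma>" and U: "stat_U \<Sigma> \<nu> x > 0"
  shows "dilate \<nu> (v / stat_U \<Sigma> \<nu> x) x = X_of \<Sigma> \<nu> v (stat_A \<Sigma> \<nu> x)"
proof -
  note [simp del] = transpose_matrix_vector
  have RW: "msqrt \<Sigma> *v (minvsqrt \<Sigma> *v y) = y" for y
    by (simp add: matrix_vector_mul_assoc minvsqrt_pos_def(2)[OF S])
  have "msqrt \<Sigma> *v fst (stat_A \<Sigma> \<nu> x) = (1 / stat_U \<Sigma> \<nu> x) *\<^sub>R (transpose x *v \<nu>)"
    by (simp add: stat_A_def stat_U_def matrix_vector_mult_scaleR RW)
  then have "X_of \<Sigma> \<nu> v (stat_A \<Sigma> \<nu> x) $ i = dilate \<nu> (v / stat_U \<Sigma> \<nu> x) x $ i" for i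
    unfolding X_of_row[OF S] snd_stat_A_row using U
    by (simp add: dilate_def left_diff_distrib diff_divide_distrib scaleR_diff_left)
  then show ?thesis by (simp add: vec_eq_iff)
qed

text \<open>After whitening, row \<open>i\<close> of the centered matrix is
  \<open>e i *\<^sub>R fst a + b i\<close>. The cross terms cancel in the sum over rows, the squares
  of \<open>e i\<close> add up to \<open>u\<^sup>2 / (norm \<nu>)\<^sup>2\<close>, and what remains
  is the density at \<open>snd a\<close>, the point of the curve at \<open>u = 0\<close>.\<close>

lemma mn_density_X_of:
  fixes \<mu> :: "real^'p^'n" and \<Sigma> :: "real^'p^'p"
  assumes S: "pos_def_mat \<Sigma>" and \<nu>: "\<nu> \<noteq> 0"
    and a: "norm (fst a) = 1" "transpose (snd a) *v \<nu> = 0" and \<mu>: "transpose \<mu> *v \<nu> = 0"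
  shows "mn_density \<mu> \<Sigma> (X_of \<Sigma> \<nu> u a) =
    exp (- u\<^sup>2 / (2 * (norm \<nu>)\<^sup>2)) * mn_density \<mu> \<Sigma> (snd a)"
proof -
  note [simp del] = transpose_matrix_vector
  let ?W = "minvsqrt \<Sigma>"
  define b where "b i = ?W *v (snd a $ i - \<mu> $ i)" for i
  define e where "e i = u * \<nu> $ i / (norm \<nu>)\<^sup>2" for i
  have quad: "y \<bullet> (matrix_inv \<Sigma> *v y) = (?W *v y) \<bullet> (?W *v y)" for y
    by (simp add: minvsqrt_pos_def(3,4)[OF S] matrix_vector_mul_assoc[symmetric]
        inner_matrix_vector_mult[of y ?W])
  have dens: "mn_density \<mu> \<Sigma> x = (\<Prod>i\<in>(UNIV::'n set). (2 * pi) powr (- real CARD('p) / 2) * det \<Sigma> powr (-1/2)) *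
      exp (\<Sum>i\<in>UNIV. - (1/2) * ((?W *v (x $ i - \<mu> $ i)) \<bullet> (?W *v (x $ i - \<mu> $ i))))" for x
    unfolding mn_density_def quad prod.distrib by (simp add: exp_sum)
  have WX: "?W *v (X_of \<Sigma> \<nu> u a $ i - \<mu> $ i) = e i *\<^sub>R fst a + b i" for i
    by (simp add: X_of_row[OF S] e_def b_def matrix_vector_mult_diff_distrib matrix_vector_right_distrib
        matrix_vector_mult_scaleR matrix_vector_mul_assoc minvsqrt_pos_def(1)[OF S])
  \<comment> \<open>As \<open>e i\<close> is proportional to \<open>\<nu> $ i\<close>, this sum is a
    whitened multiple of \<open>\<nu>\<close> applied to \<open>snd a - \<mu>\<close>. The residual
    part is orthogonal to \<open>\<nu>\<close>, and so is \<open>\<mu>\<close> under the null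
    hypothesis.\<close>
  have "(\<Sum>i\<in>UNIV. e i *\<^sub>R b i) = (u / (norm \<nu>)\<^sup>2) *\<^sub>R (?W *v (transpose (snd a) *v \<nu> - transpose \<mu> *v \<nu>))"
    unfolding transpose_matrix_vector_mult_eq_sum sum_subtractf[symmetric]
    by (simp add: e_def b_def scaleR_sum_right linear_sum[OF matrix_vector_mul_linear]
        matrix_vector_mult_scaleR scaleR_diff_right[symmetric])
  then have "(\<Sum>i\<in>UNIV. e i *\<^sub>R b i) = 0" by (simp add: a \<mu>)
  then have cross: "(\<Sum>i\<in>UNIV. e i * (fst a \<bullet> b i)) = 0"
    by (simp add: inner_sum_right[symmetric] inner_scaleR_right[symmetric] del: inner_scaleR_right)
  have "(\<Sum>i\<in>UNIV. e i * e i) = (\<Sum>i\<in>UNIV. \<nu> $ i * \<nu> $ i) * (u\<^sup>2 / ((norm \<nu>)\<^sup>2)\<^sup>2)"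
    unfolding e_def sum_distrib_right by (intro sum.cong refl) (simp add: power2_eq_square)
  then have sq: "(\<Sum>i\<in>UNIV. e i * e i) = u\<^sup>2 / (norm \<nu>)\<^sup>2"
    using \<nu> by (simp add: sum_squares_eq_norm power2_eq_square)
  have "(\<Sum>i\<in>UNIV. (e i *\<^sub>R fst a + b i) \<bullet> (e i *\<^sub>R fst a + b i)) =
      (\<Sum>i\<in>UNIV. e i * e i + 2 * (e i * (fst a \<bullet> b i)) + b i \<bullet> b i)"
  proof (intro sum.cong refl)
    fix i
    have "fst a \<bullet> fst a = 1" using a(1) by (simp add: norm_eq_1)
    then show "(e i *\<^sub>R fst a + b i) \<bullet> (e i *\<^sub>R fst a + b i) = e i * e i + 2 * (e i * (fst a \<bullet> b i)) + b i \<bullet> b i"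
      by (simp add: inner_add_left inner_add_right inner_commute)
  qed
  also have "\<dots> = u\<^sup>2 / (norm \<nu>)\<^sup>2 + (\<Sum>i\<in>UNIV. b i \<bullet> b i)"
    by (simp add: sum.distrib sq sum_distrib_left[symmetric] cross)
  finally have sum: "(\<Sum>i\<in>UNIV. (e i *\<^sub>R fst a + b i) \<bullet> (e i *\<^sub>R fst a + b i)) =
      u\<^sup>2 / (norm \<nu>)\<^sup>2 + (\<Sum>i\<in>UNIV. b i \<bullet> b i)" .
  have "exp (\<Sum>i\<in>UNIV. - (1/2) * ((e i *\<^sub>R fst a + b i) \<bullet> (e i *\<^sub>R fst a + b i))) =
      exp (- u\<^sup>2 / (2 * (norm \<nu>)\<^sup>2)) * exp (\<Sum>i\<in>UNIV. - (1/2) * (b i \<bullet> b i))"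
    unfolding sum_distrib_left[symmetric] sum exp_add[symmetric] by (simp add: algebra_simps)
  then show ?thesis unfolding dens WX b_def[symmetric] by simp
qed

section \<open>Change of variables for the dilation\<close>

lemma nn_integral_lborel_scale_row:
  fixes g :: "real^'p^'n \<Rightarrow> ennreal"
  assumes [measurable]: "g \<in> borel_measurable borel" and r: "r > 0"
  shows "(\<integral>\<^sup>+x. g x \<partial>lborel) = ennreal (r ^ CARD('p)) * (\<integral>\<^sup>+x. g (\<chi> i. if i = k then r *\<^sub>R x $ k else x $ i) \<partial>lborel)"
proof -
  let ?B = "Basis :: (real^'p^'n) set"
  \<comment> \<open>The map is diagonal in the standard basis: basis matrices supported in row
    \<open>k\<close> are multiplied by \<open>r\<close>, all others by 1. There are
    \<open>CARD('p)\<close> of the former, which fixes the exponent.\<close>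
  define c :: "real^'p^'n \<Rightarrow> real" where "c b = (if b $ k = 0 then 1 else r)" for b
  define T :: "real^'p^'n \<Rightarrow> real^'p^'n" where "T x = 0 + (\<Sum>j\<in>?B. (c j * (x \<bullet> j)) *\<^sub>R j)" for x
  have c0: "c j \<noteq> 0" for j using r by (simp add: c_def)
  have T: "T x = (\<chi> i. if i = k then r *\<^sub>R x $ k else x $ i)" for x
  proof (rule euclidean_eqI)
    fix b :: "real^'p^'n" assume b: "b \<in> ?B"
    then obtain i u where iu: "b = axis i u" "u \<in> Basis" by (auto simp: Basis_vec_def)
    have "T x \<bullet> b = c b * (x \<bullet> b)" using b by (simp add: T_def inner_sum_left_Basis)
    also have "\<dots> = (\<chi> i. if i = k then r *\<^sub>R x $ k else x $ i) \<bullet> b"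
    proof -
      have "axis i u $ k = (if k = i then u else 0)" by (simp add: axis_def)
      then show ?thesis using nonzero_Basis[OF iu(2)] by (auto simp: iu(1) c_def inner_axis)
    qed
    finally show "T x \<bullet> b = (\<chi> i. if i = k then r *\<^sub>R x $ k else x $ i) \<bullet> b" .
  qed
  have "{b \<in> ?B. b $ k \<noteq> 0} = axis k ` Basis"
  proof (intro set_eqI iffI)
    fix b assume "b \<in> {b \<in> ?B. b $ k \<noteq> 0}"
    then obtain i u where iu: "b = axis i u" "u \<in> Basis" "axis i u $ k \<noteq> 0" by (auto simp: Basis_vec_def)
    then have "i = k" by (simp add: axis_def split: if_splits)
    then show "b \<in> axis k ` Basis" using iu by simp
  next
    fix b :: "real^'p^'n" assume "b \<in> axis k ` Basis"
    then obtain u where u: "b = axis k u" "u \<in> Basis" by blast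
    have "axis k u $ k = u" by (simp add: axis_def)
    then show "b \<in> {b \<in> ?B. b $ k \<noteq> 0}"
      using u nonzero_Basis[OF u(2)] by (simp add: axis_in_Basis_iff)
  qed
  moreover have "inj_on (axis k) (Basis :: (real^'p) set)" by (auto simp: inj_on_def axis_eq_axis)
  ultimately have card: "card {b \<in> ?B. b $ k \<noteq> 0} = CARD('p)" by (simp add: card_image)
  have "(\<Prod>j\<in>?B. \<bar>c j\<bar>) = (\<Prod>j\<in>{b \<in> ?B. b $ k \<noteq> 0}. r)"
    using r by (intro prod.mono_neutral_cong_right) (auto simp: c_def)
  then have prod: "(\<Prod>j\<in>?B. \<bar>c j\<bar>) = r ^ CARD('p)" by (simp add: card)
  have [measurable]: "T \<in> borel_measurable borel" by (simp add: T_def[abs_def])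
  have "lborel = density (distr lborel borel T) (\<lambda>_. ennreal (\<Prod>j\<in>?B. \<bar>c j\<bar>))"
    unfolding T_def by (rule lborel_affine_euclidean) (rule c0)
  then have "(\<integral>\<^sup>+x. g x \<partial>lborel) = (\<integral>\<^sup>+x. g x \<partial>density (distr lborel borel T) (\<lambda>_. ennreal (r ^ CARD('p))))"
    by (simp add: prod)
  also have "\<dots> = ennreal (r ^ CARD('p)) * (\<integral>\<^sup>+x. g (T x) \<partial>lborel)"
    by (simp add: nn_integral_density nn_integral_distr nn_integral_cmult)
  finally show ?thesis by (simp add: T)
qed

text \<open>Left multiplication acts on each column separately, and the inner product of matrices is
  the sum of those of their columns.\<close>

lemma orthogonal_transformation_matrix_mult:
  fixes Q :: "real^'n^'n"
  assumes "orthogonal_matrix Q"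
  shows "orthogonal_transformation (\<lambda>x :: real^'p^'n. Q ** x)"
  unfolding orthogonal_transformation_def
proof (intro conjI allI)
  show "linear (\<lambda>x :: real^'p^'n. Q ** x)"
    by (intro linearI) (simp_all add: vec_eq_iff matrix_matrix_mult_def sum_distrib_left distrib_left sum.distrib mult_ac)
  have inner_columns: "x \<bullet> y = (\<Sum>j\<in>UNIV. column j x \<bullet> column j y)" for x y :: "real^'p^'n"
    unfolding inner_vec_def column_def by (subst sum.swap) simp
  have Q: "(Q *v v) \<bullet> (Q *v w) = v \<bullet> w" for v w
    using assms unfolding orthogonal_matrix_def
    by (simp add: inner_matrix_vector_mult matrix_vector_mul_assoc del: transpose_matrix_vector)
  have "column j (Q ** x) = Q *v column j x" for j and x :: "real^'p^'n"
    by (simp add: vec_eq_iff column_def matrix_matrix_mult_def matrix_vector_mult_def)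
  then show "(Q ** x) \<bullet> (Q ** y) = x \<bullet> y" for x y :: "real^'p^'n"
    by (simp add: inner_columns Q)
qed

text \<open>A rotation taking \<open>\<nu>\<close> to a coordinate axis conjugates the dilation to the scaling of a single row.\<close>
lemma nn_integral_dilate:
  fixes \<nu> :: "real^'n" and g :: "real^'p^'n \<Rightarrow> ennreal"
  assumes \<nu>: "\<nu> \<noteq> 0" and r: "r > 0" and [measurable]: "g \<in> borel_measurable borel"
  shows "(\<integral>\<^sup>+x. g x \<partial>lborel) = ennreal (r ^ CARD('p)) * (\<integral>\<^sup>+x. g (dilate \<nu> r x) \<partial>lborel)"
proof -
  note [simp del] = transpose_matrix_vector
  define c where "c = norm \<nu>"
  have c: "c > 0" using \<nu> by (simp add: c_def)
  obtain k :: 'n where True by simp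
  have "norm \<nu> = norm (c *\<^sub>R axis k (1::real))" using c by (simp add: c_def norm_axis_1)
  then obtain f where f: "orthogonal_transformation f" "f \<nu> = c *\<^sub>R axis k (1::real)"
    using orthogonal_transformation_exists by blast
  define Q where "Q = matrix f"
  have Q: "orthogonal_matrix Q" using f(1) by (simp add: Q_def orthogonal_transformation_matrix)
  have Q\<nu>: "Q *v \<nu> = c *\<^sub>R axis k 1"
    using f by (simp add: Q_def orthogonal_transformation_linear)
  have QT: "transpose Q ** Q = mat 1" using Q by (simp add: orthogonal_matrix_def)
  have \<nu>Q: "\<nu> = transpose Q *v (c *\<^sub>R axis k 1)"
    unfolding Q\<nu>[symmetric] by (simp add: matrix_vector_mul_assoc QT)
  have \<nu>_row: "\<nu> $ i = c * Q $ k $ i" for i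
    by (subst \<nu>Q) (simp add: matrix_vector_mult_scaleR matrix_vector_mult_basis column_def transpose_def)
  have mult_row: "(M ** x) $ i = (\<Sum>l\<in>UNIV. M $ i $ l *\<^sub>R x $ l)" for M :: "real^'n^'n" and x :: "real^'p^'n" and i
    by (simp add: vec_eq_iff matrix_matrix_mult_def)
  have w: "transpose x *v \<nu> = c *\<^sub>R (Q ** x) $ k" for x :: "real^'p^'n"
    by (simp add: transpose_matrix_vector_mult_eq_sum mult_row \<nu>_row scaleR_sum_right)
  define D where "D = (\<lambda>z :: real^'p^'n. \<chi> i. if i = k then r *\<^sub>R z $ k else z $ i)"
  \<comment> \<open>\<open>Q\<close> sends \<open>\<nu>\<close> to a multiple of
    \<open>axis k 1\<close>, so the correction term lives in row \<open>k\<close> only. There it is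
    \<open>r - 1\<close> times row \<open>k\<close> of \<open>Q ** x\<close>, because
    \<open>\<nu>\<close> is \<open>c\<close> times row \<open>k\<close> of \<open>Q\<close>.\<close>
  have conj: "Q ** dilate \<nu> r x = D (Q ** x)" for x :: "real^'p^'n"
  proof -
    have "(Q ** dilate \<nu> r x) $ i = D (Q ** x) $ i" for i
    proof -
      have "Q $ i $ l *\<^sub>R dilate \<nu> r x $ l =
          Q $ i $ l *\<^sub>R x $ l + (Q $ i $ l * \<nu> $ l * ((r - 1) / c\<^sup>2)) *\<^sub>R (transpose x *v \<nu>)" for l
        by (simp add: dilate_def c_def scaleR_add_right mult_ac)
      then have "(Q ** dilate \<nu> r x) $ i =
          (Q ** x) $ i + ((\<Sum>l\<in>UNIV. Q $ i $ l * \<nu> $ l) * ((r - 1) / c\<^sup>2)) *\<^sub>R (transpose x *v \<nu>)"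
        unfolding mult_row by (simp only: sum.distrib scaleR_sum_left sum_distrib_right)
      also have "(\<Sum>l\<in>UNIV. Q $ i $ l * \<nu> $ l) = (Q *v \<nu>) $ i" by (simp add: matrix_vector_mult_def)
      also have "\<dots> = (if i = k then c else 0)" by (simp add: Q\<nu> axis_def)
      finally show ?thesis
        using c by (simp add: D_def w power2_eq_square scaleR_diff_left)
    qed
    then show ?thesis by (simp add: vec_eq_iff)
  qed
  have cancel: "transpose Q ** (Q ** x) = x" for x :: "real^'p^'n"
    by (simp add: matrix_mul_assoc QT)
  have Tt: "orthogonal_transformation (\<lambda>x :: real^'p^'n. transpose Q ** x)"
    using Q by (intro orthogonal_transformation_matrix_mult) (simp add: orthogonal_matrix_def)
  have [measurable]: "(\<lambda>x :: real^'p^'n. transpose Q ** x) \<in> borel_measurable borel"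
    using orthogonal_transformation_linear[OF Tt]
    by (intro borel_measurable_continuous_onI linear_continuous_on) (simp add: linear_conv_bounded_linear)
  have "linear D"
    unfolding D_def by (intro linearI) (simp_all add: vec_eq_iff algebra_simps)
  then have [measurable]: "D \<in> borel_measurable borel"
    by (intro borel_measurable_continuous_onI linear_continuous_on) (simp add: linear_conv_bounded_linear)
  have "(\<integral>\<^sup>+x. g x \<partial>lborel) = (\<integral>\<^sup>+x. g (transpose Q ** x) \<partial>lborel)"
    by (rule nn_integral_lborel_orthogonal_transformation[OF Tt, symmetric]) simp
  also have "\<dots> = ennreal (r ^ CARD('p)) * (\<integral>\<^sup>+x. g (transpose Q ** D x) \<partial>lborel)"
    unfolding D_def by (rule nn_integral_lborel_scale_row) (use r in measurable)
  also have "(\<integral>\<^sup>+x. g (transpose Q ** D x) \<partial>lborel) = (\<integral>\<^sup>+x. g (transpose Q ** D (Q ** x)) \<partial>lborel)"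
    by (rule nn_integral_lborel_orthogonal_transformation[OF orthogonal_transformation_matrix_mult[OF Q], symmetric]) simp
  also have "\<dots> = (\<integral>\<^sup>+x. g (dilate \<nu> r x) \<partial>lborel)"
    by (simp only: conj[symmetric] cancel)
  finally show ?thesis .
qed

text \<open>One coordinate of \<open>transpose x *v \<nu>\<close> is already a nonzero linear
  functional of \<open>x\<close>, and its zero set is a hyperplane.\<close>

lemma AE_transpose_mult_nonzero:
  fixes \<nu> :: "real^'n"
  assumes "\<nu> \<noteq> 0"
  shows "AE x :: real^'p^'n in lborel. transpose x *v \<nu> \<noteq> 0"
proof -
  note [simp del] = transpose_matrix_vector
  obtain j :: 'p where True by simp
  define a :: "real^'p^'n" where "a = (\<chi> i. \<nu> $ i *\<^sub>R axis j 1)"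
  have "a \<noteq> 0" using assms by (auto simp: a_def vec_eq_iff axis_def)
  then have "negligible {x. a \<bullet> x = 0}" by (simp add: negligible_hyperplane)
  moreover have "{x. a \<bullet> x = 0} \<in> sets lborel" by (simp add: closed_hyperplane borel_closed)
  ultimately have null: "{x. a \<bullet> x = 0} \<in> null_sets lborel"
    by (simp add: negligible_iff_null_sets null_sets_completion_iff)
  have "a \<bullet> x = (transpose x *v \<nu>) $ j" for x
    by (simp add: a_def inner_vec_def[of "\<chi> i. _ i"] inner_axis' transpose_matrix_vector_mult_eq_sum)
  then show ?thesis
    by (intro AE_I'[OF null]) auto
qed

section \<open>Measurability of the statistics and the disintegration of Lebesgue measure\<close>

lemma continuous_on_matrix_vector_mult:
  fixes A :: "real^'n^'m"
  assumes "continuous_on S f"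
  shows "continuous_on S (\<lambda>x. A *v f x)"
  using bounded_linear.continuous_on[OF matrix_vector_mul_bounded_linear assms] .

lemma borel_measurable_mn_density [measurable]: "mn_density \<mu> \<Sigma> \<in> borel_measurable borel"
  unfolding mn_density_def[abs_def]
  by (intro borel_measurable_continuous_onI continuous_intros continuous_on_matrix_vector_mult)

lemma continuous_transpose_vector_mult:
  "continuous_on S (\<lambda>x :: real^'p^'n. transpose x *v \<nu>)"
  unfolding transpose_matrix_vector_mult_eq_sum by (intro continuous_intros)

lemma borel_measurable_stat_U [measurable]: "stat_U \<Sigma> \<nu> \<in> borel_measurable borel"
  unfolding stat_U_def[abs_def]
  by (intro borel_measurable_continuous_onI continuous_intros continuous_on_matrix_vector_mult
      continuous_transpose_vector_mult)

lemma borel_measurable_stat_A [measurable]: "stat_A \<Sigma> \<nu> \<in> borel_measurable borel"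
proof -
  have [measurable]: "(\<lambda>x. minvsqrt \<Sigma> *v (transpose x *v \<nu>)) \<in> borel_measurable borel"
    by (intro borel_measurable_continuous_onI continuous_on_matrix_vector_mult continuous_transpose_vector_mult)
  have [measurable]: "(\<lambda>x. (mat 1 - (1 / (norm \<nu>)\<^sup>2) *\<^sub>R (\<chi> i j. \<nu> $ i * \<nu> $ j)) ** x) \<in> borel_measurable borel"
    unfolding matrix_matrix_mult_def by (intro borel_measurable_continuous_onI continuous_intros)
  show ?thesis unfolding stat_A_def[abs_def] by measurable
qed

lemma borel_measurable_X_of: "(\<lambda>(v, a). X_of \<Sigma> \<nu> v a) \<in> borel_measurable borel"
  unfolding X_of_def[abs_def] vector_matrix_mult_def case_prod_beta divide_inverse vec_lambda_beta
  by (intro borel_measurable_continuous_onI continuous_on_add continuous_on_vec_lambda continuous_on_mult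
      continuous_on_sum continuous_on_component continuous_on_fst continuous_on_snd continuous_on_id continuous_on_const)

lemma borel_measurable_dilate: "(\<lambda>(r, x). dilate \<nu> r x) \<in> borel_measurable borel"
  unfolding dilate_def[abs_def] case_prod_beta transpose_matrix_vector_mult_eq_sum divide_inverse
  by (intro borel_measurable_continuous_onI continuous_on_add continuous_on_vec_lambda continuous_on_scaleR continuous_on_mult
      continuous_on_diff continuous_on_sum continuous_on_component continuous_on_fst continuous_on_snd continuous_on_id
      continuous_on_const)

lemma borel_measurable_scaled_chi_density [measurable]: "scaled_chi_density c k \<in> borel_measurable borel"
  unfolding scaled_chi_density_def[abs_def] chi_density_def by measurable

lemma AE_stat_U_pos:
  fixes \<Sigma> :: "real^'p^'p" and \<nu> :: "real^'n"
  assumes "pos_def_mat \<Sigma>" "\<nu> \<noteq> 0"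
  shows "AE x in lborel. stat_U \<Sigma> \<nu> x > 0"
  using AE_transpose_mult_nonzero[OF assms(2)]
proof (rule AE_mp, intro AE_I2 impI)
  fix x :: "real^'p^'n" assume w: "transpose x *v \<nu> \<noteq> 0"
  have "msqrt \<Sigma> *v (minvsqrt \<Sigma> *v (transpose x *v \<nu>)) = transpose x *v \<nu>"
    by (simp only: matrix_vector_mul_assoc[of "msqrt \<Sigma>"] minvsqrt_pos_def(2)[OF assms(1)] matrix_vector_mul_lid)
  then have "minvsqrt \<Sigma> *v (transpose x *v \<nu>) \<noteq> 0" using w by (metis matrix_vector_mult_0_right)
  then show "stat_U \<Sigma> \<nu> x > 0" by (simp add: stat_U_def del: transpose_matrix_vector)
qed

text \<open>The inner integral sees \<open>x\<close> only through
  \<open>stat_A \<Sigma> \<nu> x\<close>. This is the disintegration: the outer integral plays the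
  part of a measure on orbits, and identities may be checked for a fixed value of
  \<open>stat_A\<close>.\<close>

lemma nn_integral_stat_orbits:
  fixes \<Sigma> :: "real^'p^'p" and \<nu> :: "real^'n" and H :: "real^'p^'n \<Rightarrow> ennreal"
  assumes S: "pos_def_mat \<Sigma>" and \<nu>: "\<nu> \<noteq> 0" and H: "H \<in> borel_measurable borel"
  shows "(\<integral>\<^sup>+x. H x \<partial>lborel) =
    (\<integral>\<^sup>+x. indicator {x. 0 < stat_U \<Sigma> \<nu> x \<and> stat_U \<Sigma> \<nu> x < 1} x * (\<integral>\<^sup>+v. ennreal (real CARD('p) * v ^ (CARD('p) - 1)) *
       indicator {0<..} v * H (X_of \<Sigma> \<nu> v (stat_A \<Sigma> \<nu> x)) \<partial>lborel) \<partial>lborel)"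
proof -
  have "(\<integral>\<^sup>+x. H x \<partial>lborel) =
    (\<integral>\<^sup>+x. indicator {x. 0 < stat_U \<Sigma> \<nu> x \<and> stat_U \<Sigma> \<nu> x < 1} x * (\<integral>\<^sup>+v. ennreal (real CARD('p) * v ^ (CARD('p) - 1)) *
       indicator {0<..} v * H (dilate \<nu> (v / stat_U \<Sigma> \<nu> x) x) \<partial>lborel) \<partial>lborel)"
    by (rule nn_integral_dilation_orbits[OF borel_measurable_stat_U borel_measurable_dilate H _
          AE_stat_U_pos[OF S \<nu>] stat_U_dilate[OF \<nu>] nn_integral_dilate[OF \<nu>]]) simp_all
  also have "\<dots> = (\<integral>\<^sup>+x. indicator {x. 0 < stat_U \<Sigma> \<nu> x \<and> stat_U \<Sigma> \<nu> x < 1} x * (\<integral>\<^sup>+v. ennreal (real CARD('p) * v ^ (CARD('p) - 1)) *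
       indicator {0<..} v * H (X_of \<Sigma> \<nu> v (stat_A \<Sigma> \<nu> x)) \<partial>lborel) \<partial>lborel)"
    by (intro nn_integral_cong) (simp add: dilate_eq_X_of[OF S] indicator_def)
  finally show ?thesis .
qed

section \<open>The conditional distribution\<close>

theorem theorem4:
  fixes \<mu> :: "real^'p^'n" and \<Sigma> :: "real^'p^'p" and \<tau> :: real
    and d :: "'n set set \<Rightarrow> real^'p^'n \<Rightarrow> real"
    and ms :: "'n set set list" and C1 C2 :: "'n set"
  assumes Sigma_pd: "pos_def_mat \<Sigma>"
    and tau_pos: "\<tau> > 0"
    and d_nonneg: "\<And>M x. d M x \<ge> 0"
    and d_meas: "\<And>M. d M \<in> borel_measurable borel"
    and temp_pos: "AE x in lborel. \<forall>s < length ms. temp \<tau> d (part_after ms s) x > 0"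
    and m_valid: "valid_merges ms"
    and t_pos: "ms \<noteq> []"
    and last_merge: "last ms = {C1, C2}"
    and H0: "mean_row \<mu> C1 = mean_row \<mu> C2"
  shows "\<And>(u::real) (B :: ((real^'p) \<times> (real^'p^'n)) set). B \<in> sets borel \<Longrightarrow>
    (\<integral>x. mn_density \<mu> \<Sigma> x * path_prob \<tau> d ms x
          * indicator {x. stat_U \<Sigma> (contrast C1 C2) x \<le> u \<and> stat_A \<Sigma> (contrast C1 C2) x \<in> B} x \<partial>lborel)
    = (\<integral>x. mn_density \<mu> \<Sigma> x * path_prob \<tau> d ms x
          * indicator {x. stat_A \<Sigma> (contrast C1 C2) x \<in> B} x
          * cond_cdf \<Sigma> \<tau> d ms (contrast C1 C2) u (stat_A \<Sigma> (contrast C1 C2) x) \<partial>lborel)"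
proof -
  fix u :: real and B :: "((real^'p) \<times> (real^'p^'n)) set"
  assume [measurable]: "B \<in> sets borel"
  define \<nu> where "\<nu> = contrast C1 C2"
  define f where "f = mn_density \<mu> \<Sigma>"
  define q where "q = path_prob \<tau> d ms"
  define U where "U = stat_U \<Sigma> \<nu>"
  define A where "A = stat_A \<Sigma> \<nu>"
  define X where "X = X_of \<Sigma> \<nu>"
  define F where "F = cond_cdf \<Sigma> \<tau> d ms \<nu> u"
  define g where "g a v = scaled_chi_density (norm \<nu>) CARD('p) v * q (X v a)" for a v
  define N where "N a = (\<integral>v. indicator {0..u} v * g a v \<partial>lborel)" for a
  define Z where "Z a = (\<integral>v. indicator {0..} v * g a v \<partial>lborel)" for a
  note clusters = merge_clusters[OF m_valid t_pos last_merge]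
  have \<nu>: "\<nu> \<noteq> 0" unfolding \<nu>_def by (rule contrast_nonzero) (use clusters in auto)
  have \<mu>: "transpose \<mu> *v \<nu> = 0"
    unfolding transpose_matrix_vector_mult_eq_sum \<nu>_def sum_contrast_scaleR by (simp add: H0)
  have F_eq: "F a = N a / Z a" for a
    by (simp add: F_def N_def Z_def g_def cond_cdf_def q_def X_def mult.assoc)
  have [measurable]: "f \<in> borel_measurable borel" "U \<in> borel_measurable borel" "A \<in> borel_measurable borel"
    by (simp_all add: f_def U_def A_def)
  have [measurable]: "q \<in> borel_measurable borel"
    unfolding q_def by (rule borel_measurable_path_prob[OF d_meas])
  have [measurable]: "(\<lambda>(v, a). X v a) \<in> borel_measurable (borel \<Otimes>\<^sub>M borel)"
    using borel_measurable_X_of[of \<Sigma> \<nu>] by (simp add: X_def borel_prod)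
  have [measurable]: "(\<lambda>(a, v). g a v) \<in> borel_measurable (borel \<Otimes>\<^sub>M borel)"
    unfolding g_def by measurable
  have [measurable]: "N \<in> borel_measurable borel" "Z \<in> borel_measurable borel"
    unfolding N_def[abs_def] Z_def[abs_def] by measurable
  have [measurable]: "F \<in> borel_measurable borel"
    unfolding F_eq[abs_def] by measurable
  have q: "0 < q x" "q x \<le> 1" for x
    unfolding q_def by (rule path_prob_bounds[OF m_valid])+
  have f_nonneg: "0 \<le> f x" for x
    unfolding f_def mn_density_def by (intro prod_nonneg) simp
  have c: "norm \<nu> > 0" using \<nu> by simp
  obtain K where K: "K > 0" "\<And>v. v \<ge> 0 \<Longrightarrow> scaled_chi_density (norm \<nu>) CARD('p) v =
      K * (v ^ (CARD('p) - 1) * exp (- v\<^sup>2 / (2 * (norm \<nu>)\<^sup>2)))"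
    using scaled_chi_density_eq[OF c, of "CARD('p)"] by (auto simp: card_gt_0_iff)
  have g_nonneg: "0 \<le> g a v" if "v \<ge> 0" for a v
    using that K q(1)[of "X v a"] by (simp add: g_def)
  have g_pos: "0 < g a v" if "v > 0" for a v
    using that K q(1)[of "X v a"] by (simp add: g_def)
  have int_Z: "integrable lborel (\<lambda>v. indicator {0..} v * g a v)" for a
  proof (rule integrableI_bounded)
    have "(\<integral>\<^sup>+v. ennreal (norm (indicator {0..} v * g a v)) \<partial>lborel) \<le>
        (\<integral>\<^sup>+v. ennreal K * (ennreal (v ^ (CARD('p) - 1) * exp (- v\<^sup>2 / (2 * (norm \<nu>)\<^sup>2))) * indicator {0..} v) \<partial>lborel)"
    proof (rule nn_integral_mono)
      fix v :: real
      show "ennreal (norm (indicator {0..} v * g a v)) \<le>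
        ennreal K * (ennreal (v ^ (CARD('p) - 1) * exp (- v\<^sup>2 / (2 * (norm \<nu>)\<^sup>2))) * indicator {0..} v)"
      proof (cases "v \<ge> 0")
        case True
        then have "g a v \<le> K * (v ^ (CARD('p) - 1) * exp (- v\<^sup>2 / (2 * (norm \<nu>)\<^sup>2)))"
          using K q(2)[of "X v a"] unfolding g_def K(2)[OF True] by (intro mult_left_le) auto
        then show ?thesis
          using True K(1) g_nonneg[OF True] by (simp add: ennreal_mult[symmetric] ennreal_leI)
      qed simp
    qed
    also have "\<dots> < \<infinity>"
      using nn_integral_power_gaussian_finite[OF c, of "CARD('p) - 1"]
      by (subst nn_integral_cmult) (auto simp: ennreal_mult_less_top)
    finally show "(\<integral>\<^sup>+v. ennreal (norm (indicator {0..} v * g a v)) \<partial>lborel) < \<infinity>" .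
  qed measurable
  have int_N: "integrable lborel (\<lambda>v. indicator {0..u} v * g a v)" for a
    using int_Z[of a] by (rule Bochner_Integration.integrable_bound)
      (auto simp: indicator_def)
  have N_nonneg: "0 \<le> N a" for a
    unfolding N_def by (intro integral_nonneg_AE AE_I2) (auto simp: indicator_def g_nonneg)
  \<comment> \<open>Needed because division by 0 yields 0, which would break
    \<open>F a * Z a = N a\<close>. A zero integral would force the integrand to vanish almost
    everywhere, yet it is positive on all of (0, 1].\<close>
  have Z_pos: "0 < Z a" for a
  proof -
    have nn: "0 \<le> indicator {0..} v * g a v" for v by (auto simp: indicator_def g_nonneg)
    have "Z a \<noteq> 0"
    proof
      assume "Z a = 0"
      then have "AE v in lborel. indicator {0..} v * g a v = 0"
        unfolding Z_def using integral_nonneg_eq_0_iff_AE[OF int_Z[of a] AE_I2[OF nn]] by simp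
      then have "AE v in lborel. v \<notin> {0 .. 1 :: real}"
        using AE_lborel_singleton[of 0]
        by eventually_elim (use g_pos[of _ a] in \<open>force simp: indicator_def less_le\<close>)
      then have "emeasure lborel {0 .. 1 :: real} = 0"
        by (subst (asm) AE_iff_measurable[of "{0..1}"]) auto
      then show False by simp
    qed
    moreover have "0 \<le> Z a" unfolding Z_def using nn by (intro integral_nonneg_AE AE_I2)
    ultimately show ?thesis by simp
  qed
  have F_nonneg: "0 \<le> F a" for a unfolding F_eq using N_nonneg Z_pos by (simp add: less_imp_le)
  have N_nn: "(\<integral>\<^sup>+v. ennreal (indicator {0..u} v * g a v) \<partial>lborel) = ennreal (N a)" for a
    unfolding N_def by (intro nn_integral_eq_integral int_N AE_I2) (auto simp: indicator_def g_nonneg)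
  have Z_nn: "(\<integral>\<^sup>+v. ennreal (indicator {0..} v * g a v) \<partial>lborel) = ennreal (Z a)" for a
    unfolding Z_def by (intro nn_integral_eq_integral int_Z AE_I2) (auto simp: indicator_def g_nonneg)
  let ?L = "\<lambda>x. f x * q x * indicator {x. U x \<le> u \<and> A x \<in> B} x"
  let ?R = "\<lambda>x. f x * q x * indicator {x. A x \<in> B} x * F (A x)"
  have orbit: "(\<integral>\<^sup>+v. ennreal (real CARD('p) * v ^ (CARD('p) - 1)) * indicator {0<..} v * ennreal (?L (X v (A x))) \<partial>lborel) =
      (\<integral>\<^sup>+v. ennreal (real CARD('p) * v ^ (CARD('p) - 1)) * indicator {0<..} v * ennreal (?R (X v (A x))) \<partial>lborel)"
    (is "?IL = ?IR") if Ux: "U x > 0" for x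
  proof -
    let ?a = "A x"
    note a = stat_A_range[OF \<nu> Ux[unfolded U_def], folded A_def]
    \<comment> \<open>Collects the factors of the orbit integrand that are constant in
      \<open>v\<close>; the division by \<open>K\<close> compensates the constant already contained
      in \<open>g\<close>.\<close>
    define C where "C = real CARD('p) * f (snd ?a) * indicator B ?a / K"
    have C: "C \<ge> 0" using K(1) f_nonneg by (simp add: C_def)
    have UX: "U (X v ?a) = v" and AX: "A (X v ?a) = ?a" if "v > 0" for v
      unfolding U_def A_def X_def
      using stat_X_of[OF Sigma_pd \<nu> a that] by (simp_all add: A_def)
    have fX: "f (X v ?a) = exp (- v\<^sup>2 / (2 * (norm \<nu>)\<^sup>2)) * f (snd ?a)" for v
      unfolding f_def X_def by (rule mn_density_X_of[OF Sigma_pd \<nu> a \<mu>])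
    have eq: "real CARD('p) * v ^ (CARD('p) - 1) * (f (X v ?a) * q (X v ?a) * indicator B ?a) = C * g ?a v"
      if "v > 0" for v
      using that K(1) by (simp add: C_def g_def K(2) fX)
    \<comment> \<open>On the orbit \<open>U\<close> equals \<open>v\<close>, so the event
      \<open>U\<close> \<le> \<open>u\<close> becomes the cutoff at \<open>u\<close>. The two
      indicators disagree about \<open>v = 0\<close> alone, a null set.\<close>
    have "?IL = (\<integral>\<^sup>+v. ennreal C * ennreal (indicator {0..u} v * g ?a v) \<partial>lborel)"
    proof (rule nn_integral_cong_AE)
      show "AE v in lborel. ennreal (real CARD('p) * v ^ (CARD('p) - 1)) * indicator {0<..} v * ennreal (?L (X v ?a)) =
          ennreal C * ennreal (indicator {0..u} v * g ?a v)"
        using AE_lborel_singleton[of 0]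
      proof eventually_elim
        fix v :: real assume "v \<noteq> 0"
        show "ennreal (real CARD('p) * v ^ (CARD('p) - 1)) * indicator {0<..} v * ennreal (?L (X v ?a)) =
          ennreal C * ennreal (indicator {0..u} v * g ?a v)"
        proof (cases "v > 0")
          case v: True
          have "real CARD('p) * v ^ (CARD('p) - 1) * ?L (X v ?a) = C * (indicator {0..u} v * g ?a v)"
            using eq[OF v] v by (simp add: UX AX indicator_def)
          then show ?thesis using v C f_nonneg q g_nonneg[of v ?a]
            by (simp add: ennreal_mult[symmetric] less_imp_le)
        next
          case False
          then show ?thesis using \<open>v \<noteq> 0\<close> by (simp add: indicator_def)
        qed
      qed
    qed
    also have "\<dots> = ennreal C * ennreal (N ?a)" by (subst nn_integral_cmult) (auto simp: N_nn)
    also have "\<dots> = ennreal (C * F ?a) * ennreal (Z ?a)"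
      using C N_nonneg[of ?a] Z_pos[of ?a] by (simp add: ennreal_mult[symmetric] F_eq)
    also have "\<dots> = (\<integral>\<^sup>+v. ennreal (C * F ?a) * ennreal (indicator {0..} v * g ?a v) \<partial>lborel)"
      by (subst nn_integral_cmult) (auto simp: Z_nn)
    also have "\<dots> = ?IR"
    proof (rule nn_integral_cong_AE)
      show "AE v in lborel. ennreal (C * F ?a) * ennreal (indicator {0..} v * g ?a v) =
          ennreal (real CARD('p) * v ^ (CARD('p) - 1)) * indicator {0<..} v * ennreal (?R (X v ?a))"
        using AE_lborel_singleton[of 0]
      proof eventually_elim
        fix v :: real assume "v \<noteq> 0"
        show "ennreal (C * F ?a) * ennreal (indicator {0..} v * g ?a v) =
          ennreal (real CARD('p) * v ^ (CARD('p) - 1)) * indicator {0<..} v * ennreal (?R (X v ?a))"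
        proof (cases "v > 0")
          case v: True
          have "real CARD('p) * v ^ (CARD('p) - 1) * ?R (X v ?a) = (C * g ?a v) * F ?a"
            using v by (simp add: eq[OF v, symmetric] AX indicator_def)
          then show ?thesis using v C F_nonneg f_nonneg q g_nonneg[of v ?a]
            by (simp add: ennreal_mult[symmetric] less_imp_le mult_ac)
        next
          case False
          then show ?thesis using \<open>v \<noteq> 0\<close> by (simp add: indicator_def)
        qed
      qed
    qed
    finally show ?thesis .
  qed
  have "(\<integral>\<^sup>+x. ennreal (?L x) \<partial>lborel) = (\<integral>\<^sup>+x. ennreal (?R x) \<partial>lborel)"
    using orbit unfolding X_def U_def A_def
    by (subst (1 2) nn_integral_stat_orbits[OF Sigma_pd \<nu>])
      (auto intro!: nn_integral_cong simp: indicator_def simp del: indicator_simps simp flip: U_def A_def)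
  \<comment> \<open>For nonnegative measurable integrands the Bochner integral is the real value of
    the nonnegative one, so equality transfers directly.\<close>
  then have "(\<integral>x. ?L x \<partial>lborel) = (\<integral>x. ?R x \<partial>lborel)"
    using f_nonneg q F_nonneg by (subst (1 2) integral_eq_nn_integral) (auto simp: less_imp_le)
  then show "(\<integral>x. mn_density \<mu> \<Sigma> x * path_prob \<tau> d ms x
          * indicator {x. stat_U \<Sigma> (contrast C1 C2) x \<le> u \<and> stat_A \<Sigma> (contrast C1 C2) x \<in> B} x \<partial>lborel)
    = (\<integral>x. mn_density \<mu> \<Sigma> x * path_prob \<tau> d ms x
          * indicator {x. stat_A \<Sigma> (contrast C1 C2) x \<in> B} x
          * cond_cdf \<Sigma> \<tau> d ms (contrast C1 C2) u (stat_A \<Sigma> (contrast C1 C2) x) \<partial>lborel)"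
    by (simp only: f_def q_def U_def A_def F_def \<nu>_def)
qed
end
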